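(* For each $n$ let $G_{(n)}=G_1(n,m,P)$ be the active random intersection graph with $m=m_n$ and $P=P_n$ depending on $n$, and let $X_1=|D_1|$ be the size of the attribute set of vertex $v_1$. Let $m,n\to\infty$ and put $\beta_n=m/n$. Assume that there is a random variable $Z$ such that (i) $X_1\sqrt{n/m}$ converges in distribution to $Z$; (ii-2) $\mathbf{E} Z^2<\infty$ and $\mathbf{E}(X_1\sqrt{n/m})^2$ converges to $\mathbf{E} Z^2$; and that $\mathbf{E} Z>0$. Suppose that $\beta_n\to\beta\in(0,+\infty)$. Denote $\Lambda=\sqrt{\delta_1/\beta}$. Then, as $n\to\infty$, $$ cl(r)= \begin{cases} p_e e^{-\Lambda}(1+o(1)), & r=0;\\[2pt] \dfrac{\alpha}{\alpha+(1-\alpha)e^{\Lambda}}(1+o(1)), & r=1;\\[6pt] 1-o(1), & \text{for each fixed integer } r\ge 2. \end{cases} $$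
   Context: Active random intersection graph $G_1(n,m,P)$: the vertex set is $V=\{v_1,\dots,v_n\}$, the set of attributes is $W=\{w_1,\dots,w_m\}$, and $P$ is a probability distribution on $\{0,1,\dots,m\}$. Each vertex $v_i$ is assigned a random subset $D_i\subset W$; the sets $D_1,\dots,D_n$ are independent and identically distributed with $\mathbf{P}(D_i=A)=\binom{m}{|A|}^{-1}P(|A|)$ for every $A\subset W$. (Thus $X_i:=|D_i|$ has distribution $P$ and, given its size, $D_i$ is uniformly distributed.) Distinct vertices $v_i,v_j$ are adjacent, written $v_i\sim v_j$, iff $D_i\cap D_j\neq\emptyset$. Notation (all quantities refer to $G_{(n)}$ and depend on $n$, except $\delta_k$): $d(v_1,v_2)$ is the number of common neighbours of $v_1$ and $v_2$. The clustering function is $cl(r)=\mathbf{P}(v_1\sim v_2\mid d(v_1,v_2)=r)$, $r=0,1,2,\dots$. The edge probability is $p_e=\mathbf{P}(v_1\sim v_2)$. The clustering coefficient is $\alpha=\mathbf{P}(v_1\sim v_2\mid v_1\sim v_3,\ v_2\sim v_3)$. Finally $\delta_k=\mathbf{E} d_*^k$, where $d_*$ is a random variable with the mixed Poisson distribution $\mathbf{P}(d_*=k)=\mathbf{E}\, e^{-z_1Z}(z_1Z)^k/k!$, $k=0,1,\dots$, with $z_1=\mathbf{E} Z$. *)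

theory Defs
  imports "HOL-Probability.Probability" "HOL-Library.Landau_Symbols"
begin

unbundle asymp_equiv_syntax

definition attribute_set :: "nat \<Rightarrow> nat pmf \<Rightarrow> nat set pmf" where
  "attribute_set m P = bind_pmf P (\<lambda>k. pmf_of_set {A. A \<subseteq> {1..m} \<and> card A = k})"

lemma pmf_attribute_set:
  assumes P: "set_pmf P \<subseteq> {0..m}" and A: "A \<subseteq> {1..m}"
  shows "pmf (attribute_set m P) A = pmf P (card A) / real (m choose card A)"
proof -
  have fin: "finite {B. B \<subseteq> {1..m} \<and> card B = k}" for k
    by (rule finite_subset[of _ "Pow {1..m}"]) auto
  have card: "card {B. B \<subseteq> {1..m} \<and> card B = k} = m choose k" for k
    using n_subsets[of "{1..m}" k] by simp
  have "pmf (attribute_set m P) A =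
      (\<Sum>k\<in>{0..m}. pmf (pmf_of_set {B. B \<subseteq> {1..m} \<and> card B = k}) A * pmf P k)"
    unfolding attribute_set_def pmf_bind
    using P by (intro integral_measure_pmf_real) auto
  also have "\<dots> = (\<Sum>k\<in>{0..m}. if k = card A then pmf P k / real (m choose k) else 0)"
  proof (rule sum.cong[OF refl])
    fix k assume "k \<in> {0..m}"
    then have "card {B. B \<subseteq> {1..m} \<and> card B = k} \<noteq> 0"
      unfolding card by simp
    then have ne: "{B. B \<subseteq> {1..m} \<and> card B = k} \<noteq> {}"
      by (rule contrapos_nn) (simp only: card.empty)
    show "pmf (pmf_of_set {B. B \<subseteq> {1..m} \<and> card B = k}) A * pmf P k =
        (if k = card A then pmf P k / real (m choose k) else 0)"
      unfolding pmf_of_set[OF ne fin] card using A by (auto simp: indicator_def)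
  qed
  also have "\<dots> = pmf P (card A) / real (m choose card A)"
    using card_mono[OF _ A] by simp
  finally show ?thesis .
qed

definition active_rig :: "nat \<Rightarrow> nat \<Rightarrow> nat pmf \<Rightarrow> (nat \<Rightarrow> nat set) pmf" where
  "active_rig n m P = Pi_pmf {1..n} {} (\<lambda>_. attribute_set m P)"

definition adjacent :: "(nat \<Rightarrow> nat set) \<Rightarrow> nat \<Rightarrow> nat \<Rightarrow> bool" where
  "adjacent D i j \<longleftrightarrow> i \<noteq> j \<and> D i \<inter> D j \<noteq> {}"

definition common_neighbours :: "nat \<Rightarrow> (nat \<Rightarrow> nat set) \<Rightarrow> nat \<Rightarrow> nat \<Rightarrow> nat" where
  "common_neighbours n D i j = card {k \<in> {1..n}. adjacent D i k \<and> adjacent D j k}"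

definition clustering_function :: "nat \<Rightarrow> nat \<Rightarrow> nat pmf \<Rightarrow> nat \<Rightarrow> real" where
  "clustering_function n m P r =
     \<P>(D in active_rig n m P. adjacent D 1 2 \<bar> common_neighbours n D 1 2 = r)"

definition edge_probability :: "nat \<Rightarrow> nat \<Rightarrow> nat pmf \<Rightarrow> real" where
  "edge_probability n m P = \<P>(D in active_rig n m P. adjacent D 1 2)"

definition clustering_coefficient :: "nat \<Rightarrow> nat \<Rightarrow> nat pmf \<Rightarrow> real" where
  "clustering_coefficient n m P =
     \<P>(D in active_rig n m P. adjacent D 1 2 \<bar> adjacent D 1 3 \<and> adjacent D 2 3)"

definition mixed_poisson :: "'a measure \<Rightarrow> ('a \<Rightarrow> real) \<Rightarrow> nat pmf" where
  "mixed_poisson N Z =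
     (let z1 = (\<integral>x. Z x \<partial>N)
      in embed_pmf (\<lambda>k. \<integral>x. exp (- z1 * Z x) * (z1 * Z x) ^ k / fact k \<partial>N))"

text \<open>The next lemma shows that the argument of \<^const>\<open>embed_pmf\<close> is indeed a probability
  mass function when \<open>Z\<close> is almost surely nonnegative, as is every weak limit of nonnegative
  random variables.\<close>

lemma pmf_mixed_poisson:
  assumes "prob_space N" and Z[measurable]: "Z \<in> borel_measurable N" and nonneg: "AE x in N. Z x \<ge> 0"
  defines "z1 \<equiv> \<integral>x. Z x \<partial>N"
  shows "pmf (mixed_poisson N Z) k = (\<integral>x. exp (- z1 * Z x) * (z1 * Z x) ^ k / fact k \<partial>N)"
proof -
  interpret prob_space N by fact
  define f where "f = (\<lambda>k x. exp (- z1 * Z x) * (z1 * Z x) ^ k / fact k)"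
  have z1: "z1 \<ge> 0"
    unfolding z1_def using nonneg by (rule integral_nonneg_AE)
  have f_meas[measurable]: "f k \<in> borel_measurable N" for k
    unfolding f_def by measurable
  have f_nonneg: "AE x in N. f k x \<ge> 0" for k
    using nonneg by eventually_elim (simp add: f_def z1)
  have sums: "(\<lambda>k. f k x) sums 1" for x
  proof -
    have "(\<lambda>k. exp (- z1 * Z x) * ((z1 * Z x) ^ k /\<^sub>R fact k)) sums
        (exp (- z1 * Z x) * exp (z1 * Z x))"
      by (intro sums_mult exp_converges)
    also have "exp (- z1 * Z x) * exp (z1 * Z x) = 1"
      by (simp add: exp_minus)
    also have "(\<lambda>k. exp (- z1 * Z x) * ((z1 * Z x) ^ k /\<^sub>R fact k)) = (\<lambda>k. f k x)"
      by (simp add: f_def field_simps)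
    finally show ?thesis .
  qed
  have "AE x in N. \<forall>k. f k x \<ge> 0"
    unfolding AE_all_countable using f_nonneg by blast
  then have total: "AE x in N. (\<Sum>k. ennreal (f k x)) = 1"
  proof eventually_elim
    case (elim x)
    have "(\<Sum>k. ennreal (f k x)) = ennreal (\<Sum>k. f k x)"
      using elim by (intro suminf_ennreal2 sums_summable[OF sums]) auto
    then show ?case
      using sums_unique[OF sums[of x]] by simp
  qed
  have sum1: "(\<Sum>k. \<integral>\<^sup>+x. ennreal (f k x) \<partial>N) = 1"
  proof -
    have "(\<Sum>k. \<integral>\<^sup>+x. ennreal (f k x) \<partial>N) = (\<integral>\<^sup>+x. (\<Sum>k. ennreal (f k x)) \<partial>N)"
      by (rule nn_integral_suminf[symmetric]) measurable
    also have "\<dots> = (\<integral>\<^sup>+x. 1 \<partial>N)"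
      using total by (rule nn_integral_cong_AE)
    finally show ?thesis by (simp add: emeasure_space_1)
  qed
  have fin: "(\<integral>\<^sup>+x. ennreal (f k x) \<partial>N) < \<infinity>" for k
  proof -
    have "(\<integral>\<^sup>+x. ennreal (f k x) \<partial>N) \<le> (\<Sum>k. \<integral>\<^sup>+x. ennreal (f k x) \<partial>N)"
      using sum_le_suminf[of "\<lambda>k. \<integral>\<^sup>+x. ennreal (f k x) \<partial>N" "{k}"] by simp
    also have "\<dots> < \<infinity>"
      unfolding sum1 by simp
    finally show ?thesis .
  qed
  have int: "integrable N (f k)" for k
    using fin f_nonneg by (intro integrableI_nonneg) auto
  have eq: "ennreal (\<integral>x. f k x \<partial>N) = (\<integral>\<^sup>+x. ennreal (f k x) \<partial>N)" for k
    using nn_integral_eq_integral[OF int f_nonneg] by simp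
  have "pmf (embed_pmf (\<lambda>k. \<integral>x. f k x \<partial>N)) k = (\<integral>x. f k x \<partial>N)"
  proof (rule pmf_embed_pmf)
    show "(\<integral>x. f k x \<partial>N) \<ge> 0" for k
      using f_nonneg by (rule integral_nonneg_AE)
    show "(\<integral>\<^sup>+k. ennreal (\<integral>x. f k x \<partial>N) \<partial>count_space UNIV) = 1"
      by (simp add: nn_integral_count_space_nat eq sum1)
  qed
  then show ?thesis
    by (simp add: mixed_poisson_def Let_def f_def z1_def)
qed

definition mixed_poisson_moment :: "'a measure \<Rightarrow> ('a \<Rightarrow> real) \<Rightarrow> nat \<Rightarrow> real" where
  "mixed_poisson_moment N Z k = measure_pmf.expectation (mixed_poisson N Z) (\<lambda>d. real d ^ k)"

end

(* The clustering function is governed by the number of attributes shared by v1 and v2. Given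
   disjoint attribute sets, a common neighbour needs two different attributes, one in each set,
   so each further common neighbour costs a factor of order 1/m. Given exactly one shared
   attribute w (probability about mu^2/m, where mu is the limit of E X_1), the common neighbours
   are essentially the other vertices holding w, and their number is asymptotically Poisson with
   mean mu/beta = Lambda. Two shared attributes have probability O(1/m^2).

   All error terms are sums of products of the probabilities p1 = P(a in D) and p2 = P(a, b in D),
   where m p1 = E X_1 and m^2 p2 is bounded by 2 E X_1^2, so only the first two moments matter.
   For r = 1 no asymptotics of P(v1 ~ v3, v2 ~ v3, not v1 ~ v2) is needed: by exchangeability the
   same probability appears in alpha and, multiplied by n - 2, in P(d = 1, not v1 ~ v2), and it
   is enough that it is O(1/m^2). *)
theory Submission
  imports Defs
begin

section \<open>Attribute sets and random intersection graphs\<close>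

text \<open>The hypotheses control X_1 sqrt(n/m) only through a weak limit and its second moments,
  whereas the estimates need E X_1. Bounded second moments make the normalised sizes uniformly
  integrable, so their means tend to z = E Z and E X_1 tends to \<mu> = sqrt \<beta> z. The mixed
  Poisson law has mean z^2, which turns \<Lambda> into \<mu>/\<beta>.

  Every probability is sandwiched between means of counts by pointwise inequalities such as c - c(c
  - 1) \<le> [c > 0] \<le> c. A count is a sum of events "this vertex holds these attributes", and
  independence of the vertices makes its mean a sum of explicit products.

  The obstacle is r = 1, where the adjacent and the non-adjacent part may have the same order. The
  non-adjacent part is only known to be bounded after rescaling, so \<alpha> is not shown to
  converge and the formula cannot be read off from limits of its two sides. Instead
  \<open>ratio_asymp_equiv\<close> shows directly that the quotient of the two sides tends to
  1.\<close>

lemma set_attribute_set: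
  assumes "set_pmf P \<subseteq> {0..m}"
  shows "set_pmf (attribute_set m P) \<subseteq> Pow {1..m}"
proof -
  have "set_pmf (pmf_of_set {A. A \<subseteq> {1..m} \<and> card A = k}) \<subseteq> Pow {1..m}" if "k \<le> m" for k
  proof -
    have fin: "finite {A. A \<subseteq> {1..m} \<and> card A = k}"
      by (rule finite_subset[of _ "Pow {1..m}"]) auto
    have "card {A. A \<subseteq> {1..m} \<and> card A = k} = m choose k"
      using n_subsets[of "{1..m}" k] by simp
    with that have "{A. A \<subseteq> {1..m} \<and> card A = k} \<noteq> {}"
      by (metis binomial_eq_0_iff card.empty not_le)
    with fin show ?thesis
      by (auto simp: set_pmf_of_set)
  qed
  with assms show ?thesis
    by (fastforce simp: attribute_set_def)
qed

text \<open>The weight of an outcome depends only on its cardinality, so a permutation of {1..m}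
  that carries \<open>S\<close> onto \<open>S'\<close> preserves the law. This lets one number
  \<open>p1\<close> serve all attributes and one number \<open>p2\<close> all pairs.\<close>

lemma prob_subset_attribute_set_cong:
  assumes P: "set_pmf P \<subseteq> {0..m}"
    and S: "S \<subseteq> {1..m}" and S': "S' \<subseteq> {1..m}" and card: "card S = card S'"
  shows "measure_pmf.prob (attribute_set m P) {A. S \<subseteq> A} = measure_pmf.prob (attribute_set m P) {A. S' \<subseteq> A}"
proof -
  define M where "M = {1..m}"
  have [simp]: "finite M" "finite S" "finite S'"
    using S S' by (auto simp: M_def intro: finite_subset)
  have sub: "S \<subseteq> M" "S' \<subseteq> M" using S S' by (auto simp: M_def)
  obtain g where g: "bij_betw g S S'"
    using card by (metis finite_same_card_bij \<open>finite S\<close> \<open>finite S'\<close>)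
  have "card (M - S) = card (M - S')"
    using card sub by (simp add: card_Diff_subset)
  then obtain h where h: "bij_betw h (M - S) (M - S')"
    by (metis finite_same_card_bij finite_Diff \<open>finite M\<close>)
  \<comment> \<open>Glued from bijections between \<open>S\<close> and \<open>S'\<close> and between
    their complements, \<open>f\<close> permutes \<open>M\<close>; a subset of \<open>M\<close>
    contains \<open>S\<close> iff its image contains \<open>S'\<close>.\<close>
  define f where "f x = (if x \<in> S then g x else h x)" for x
  have fS: "bij_betw f S S'"
    using g by (subst bij_betw_cong[of _ _ g]) (auto simp: f_def)
  have fMS: "bij_betw f (M - S) (M - S')"
    using h by (subst bij_betw_cong[of _ _ h]) (auto simp: f_def)
  have "bij_betw f (S \<union> (M - S)) (S' \<union> (M - S'))"
    by (rule bij_betw_combine[OF fS fMS]) auto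
  then have fM: "bij_betw f M M"
    using sub by (simp add: Un_absorb1)
  have injf: "inj_on f M" using fM by (rule bij_betw_imp_inj_on)
  have Pow: "bij_betw (image f) (Pow M) (Pow M)"
    by (rule bij_betw_Pow[OF fM])
  have img: "image f ` {A \<in> Pow M. S \<subseteq> A} = {A \<in> Pow M. S' \<subseteq> A}"
  proof (intro equalityI subsetI)
    fix B assume "B \<in> image f ` {A \<in> Pow M. S \<subseteq> A}"
    then show "B \<in> {A \<in> Pow M. S' \<subseteq> A}"
      using bij_betw_imp_surj_on[OF fS] bij_betw_imp_surj_on[OF fM] by blast
  next
    fix B assume B: "B \<in> {A \<in> Pow M. S' \<subseteq> A}"
    then have "B \<in> image f ` Pow M" using bij_betw_imp_surj_on[OF Pow] by simp
    then obtain A where A: "A \<in> Pow M" "B = f ` A" by (elim imageE)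
    have "f ` S \<subseteq> f ` A" using B A bij_betw_imp_surj_on[OF fS] by simp
    then have "S \<subseteq> A" using injf A sub by (simp add: inj_on_image_subset_iff)
    with A show "B \<in> image f ` {A \<in> Pow M. S \<subseteq> A}" by auto
  qed
  have bij: "bij_betw (image f) {A \<in> Pow M. S \<subseteq> A} {A \<in> Pow M. S' \<subseteq> A}"
    unfolding bij_betw_def
  proof
    show "inj_on (image f) {A \<in> Pow M. S \<subseteq> A}"
      by (rule inj_on_subset[OF bij_betw_imp_inj_on[OF Pow]]) auto
  qed (rule img)
  have eq: "measure_pmf.prob (attribute_set m P) {A. T \<subseteq> A} =
      (\<Sum>A\<in>{A \<in> Pow M. T \<subseteq> A}. pmf (attribute_set m P) A)" for T
  proof -
    have "measure_pmf.prob (attribute_set m P) {A. T \<subseteq> A} = measure_pmf.prob (attribute_set m P) {A \<in> Pow M. T \<subseteq> A}"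
      using set_attribute_set[OF P] by (intro measure_pmf.finite_measure_eq_AE) (auto simp: AE_measure_pmf_iff M_def)
    then show ?thesis
      by (simp add: measure_measure_pmf_finite)
  qed
  have "(\<Sum>A\<in>{A \<in> Pow M. S \<subseteq> A}. pmf (attribute_set m P) (f ` A)) =
      (\<Sum>A\<in>{A \<in> Pow M. S' \<subseteq> A}. pmf (attribute_set m P) A)"
    by (rule sum.reindex_bij_betw[OF bij])
  moreover have "pmf (attribute_set m P) (f ` A) = pmf (attribute_set m P) A" if "A \<in> Pow M" for A
  proof -
    have "f ` A \<subseteq> f ` M" using that by (intro image_mono) simp
    then have "f ` A \<subseteq> M" using bij_betw_imp_surj_on[OF fM] by simp
    moreover have "card (f ` A) = card A"
      using inj_on_subset[OF injf] that by (simp add: card_image)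
    ultimately show ?thesis
      using that by (simp add: pmf_attribute_set[OF P] M_def)
  qed
  ultimately show ?thesis
    by (simp add: eq)
qed

lemma prob_Pi_pmf_ball:
  assumes "finite I" "J \<subseteq> I"
  shows "measure_pmf.prob (Pi_pmf I d p) {f. \<forall>j\<in>J. f j \<in> B j} = (\<Prod>j\<in>J. measure_pmf.prob (p j) (B j))"
proof -
  have "{f. \<forall>j\<in>J. f j \<in> B j} = Pi I (\<lambda>j. if j \<in> J then B j else UNIV)"
    using assms by (auto simp: Pi_def)
  moreover have "(\<Prod>j\<in>I. measure_pmf.prob (p j) (if j \<in> J then B j else UNIV)) =
     (\<Prod>j\<in>J. measure_pmf.prob (p j) (B j))"
    using assms by (intro prod.mono_neutral_cong_right) auto
  ultimately show ?thesis
    by (simp add: measure_Pi_pmf_Pi[OF assms(1)])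
qed

lemma finite_set_active_rig:
  assumes "set_pmf P \<subseteq> {0..m}"
  shows "finite (set_pmf (active_rig n m P))"
proof -
  have "finite (set_pmf (attribute_set m P))"
    using set_attribute_set[OF assms] by (rule finite_subset) simp
  then show ?thesis
    unfolding active_rig_def by (subst set_Pi_pmf) auto
qed

section \<open>Counts and ordered pairs as sums of indicators\<close>

lemma card_eq_sum_of_bool:
  assumes "finite M" "A \<subseteq> M"
  shows "real (card A) = (\<Sum>a\<in>M. of_bool (a \<in> A))"
  using assms by (simp add: of_bool_def sum.If_cases Int_absorb1)

lemma card_pairs_eq_sum_of_bool:
  assumes "finite M" "A \<subseteq> M"
  shows "real (card A) * (real (card A) - 1) = (\<Sum>a\<in>M. \<Sum>b\<in>M - {a}. of_bool (a \<in> A \<and> b \<in> A))"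
proof -
  have fin: "finite A" using assms by (rule finite_subset[rotated])
  have "(\<Sum>b\<in>M - {a}. of_bool (a \<in> A \<and> b \<in> A)) = of_bool (a \<in> A) * (real (card A) - 1)" for a
  proof (cases "a \<in> A")
    case True
    have "(\<Sum>b\<in>M - {a}. of_bool (b \<in> A - {a})) = real (card (A - {a}))"
      using assms by (intro card_eq_sum_of_bool[symmetric]) auto
    also have "\<dots> = real (card A) - 1"
      using True fin by (metis card.remove of_nat_Suc add_diff_cancel_left')
    also have "(\<Sum>b\<in>M - {a}. of_bool (b \<in> A - {a})) = (\<Sum>b\<in>M - {a}. of_bool (a \<in> A \<and> b \<in> A))"
      using True by (intro sum.cong) auto
    finally show ?thesis using True by simp
  qed simp
  then have "(\<Sum>a\<in>M. \<Sum>b\<in>M - {a}. of_bool (a \<in> A \<and> b \<in> A)) = (\<Sum>a\<in>M. of_bool (a \<in> A)) * (real (card A) - 1)"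
    by (simp add: sum_distrib_right)
  then show ?thesis using card_eq_sum_of_bool[OF assms] by simp
qed

lemma of_bool_le_sum:
  assumes "finite S" "\<And>i. i \<in> S \<Longrightarrow> f i \<ge> (0::real)" "Q \<Longrightarrow> \<exists>i\<in>S. f i \<ge> 1"
  shows "of_bool Q \<le> sum f S"
proof (cases Q)
  case True
  then obtain i where "i \<in> S" "f i \<ge> 1" using assms by blast
  then show ?thesis using member_le_sum[of i S f] assms by auto
qed (simp add: sum_nonneg assms)

text \<open>For c elements the lower bound is 1 - (c - 1)^2, which is at most 1 and vanishes at c =
  0. Bonferroni would subtract only c(c - 1)/2; ordered pairs are cruder but fit
  \<open>card_pairs_eq_sum_of_bool\<close> and only enter error terms.\<close>

lemma card_nonempty_bounds:
  assumes "finite A"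
  shows "of_bool (A \<noteq> {}) \<le> real (card A)"
    and "real (card A) - real (card A) * (real (card A) - 1) \<le> of_bool (A \<noteq> {})"
proof -
  show "of_bool (A \<noteq> {}) \<le> real (card A)"
    using assms by (cases "A = {}") (auto simp: Suc_le_eq card_gt_0_iff)
  have "real c - real c * (real c - 1) \<le> 1" for c :: nat
    using zero_le_power2[of "real c - 1"] by (simp add: power2_eq_square algebra_simps)
  then show "real (card A) - real (card A) * (real (card A) - 1) \<le> of_bool (A \<noteq> {})"
    by (cases "A = {}") auto
qed

section \<open>Bounds for a single graph\<close>

text \<open>\<open>n \<ge> 3\<close> provides the vertices 1, 2, 3 of the triangle event,
  \<open>m \<ge> 2\<close> the attributes 1 and 2 that represent all pairs in
  \<open>p2\<close>.\<close>

locale active_graph =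
  fixes n m :: nat and P :: "nat pmf"
  assumes P: "set_pmf P \<subseteq> {0..m}" and n: "n \<ge> 3" and m: "m \<ge> 2"
begin

abbreviation "G \<equiv> active_rig n m P"
abbreviation "E \<equiv> measure_pmf.expectation G"
abbreviation "M \<equiv> {1..m}"
abbreviation "K \<equiv> {3..n}"

definition incl :: "nat set \<Rightarrow> real" where
  "incl S = measure_pmf.prob (attribute_set m P) {A. S \<subseteq> A}"
definition "p1 = incl {1}"
definition "p2 = incl {1, 2}"

lemma p_nonneg: "p1 \<ge> 0" "p2 \<ge> 0" "p1 \<le> 1"
  by (auto simp: p1_def p2_def incl_def)

lemma incl_single: "a \<in> M \<Longrightarrow> incl {a} = p1"
  unfolding incl_def p1_def using m by (intro prob_subset_attribute_set_cong[OF P]) auto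

lemma incl_pair: "a \<in> M \<Longrightarrow> b \<in> M \<Longrightarrow> a \<noteq> b \<Longrightarrow> incl {a, b} = p2"
  unfolding incl_def p2_def using m by (intro prob_subset_attribute_set_cong[OF P]) auto

lemma finite_set_G: "finite (set_pmf G)"
  by (rule finite_set_active_rig[OF P])

lemma set_G: "D \<in> set_pmf G \<Longrightarrow> D i \<subseteq> M"
proof -
  assume "D \<in> set_pmf G"
  then have "D \<in> PiE_dflt {1..n} {} (set_pmf \<circ> (\<lambda>_. attribute_set m P))"
    using set_Pi_pmf_subset'[of "{1..n}" "{}" "\<lambda>_. attribute_set m P"] by (auto simp: active_rig_def)
  then have "D i \<in> set_pmf (attribute_set m P) \<or> D i = {}"
    by (cases "i \<in> {1..n}") (auto simp: PiE_dflt_def)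
  then show ?thesis
    using set_attribute_set[OF P] by blast
qed

lemma integrable_G [simp]: "integrable G (f :: _ \<Rightarrow> real)"
  by (rule integrable_measure_pmf_finite[OF finite_set_G])

text \<open>Turns bounds on probabilities into pointwise inequalities between counting functions.
  These need to hold only when all sets lie in \<open>M\<close>, which is almost sure; indices
  outside {1..n} carry the default value {}.\<close>

lemma E_mono: "(\<And>D. \<forall>i. D i \<subseteq> M \<Longrightarrow> f D \<le> (g D :: real)) \<Longrightarrow> E f \<le> E g"
  by (rule integral_mono_AE) (use set_G in \<open>auto simp del: One_nat_def simp: AE_measure_pmf_iff\<close>)

lemma E_cong: "(\<And>D. \<forall>i. D i \<subseteq> M \<Longrightarrow> f D = (g D :: real)) \<Longrightarrow> E f = E g"
  by (rule integral_cong_AE) (use set_G in \<open>auto simp del: One_nat_def simp: AE_measure_pmf_iff\<close>)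

lemma E_of_bool: "E (\<lambda>D. of_bool (Q D)) = measure_pmf.prob G {D. Q D}"
proof -
  have "E (\<lambda>D. of_bool (Q D)) = E (indicator {D. Q D})"
    by (intro arg_cong[where f=E]) (auto simp: indicator_def)
  also have "\<dots> = measure_pmf.prob G {D. Q D}"
    by (simp del: indicator_simps)
  finally show ?thesis .
qed

lemma E_ball:
  assumes "J \<subseteq> {1..n}"
  shows "E (\<lambda>D. of_bool (\<forall>j\<in>J. D j \<in> B j)) = (\<Prod>j\<in>J. measure_pmf.prob (attribute_set m P) (B j))"
proof -
  have "measure_pmf.prob G {D. \<forall>j\<in>J. D j \<in> B j} = (\<Prod>j\<in>J. measure_pmf.prob (attribute_set m P) (B j))"
    unfolding active_rig_def by (rule prob_Pi_pmf_ball) (use assms in auto)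
  then show ?thesis by (simp only: E_of_bool)
qed

section \<open>Independence: inclusion events at distinct vertices multiply\<close>

lemma E_incl2: "E (\<lambda>D. of_bool (S1 \<subseteq> D 1 \<and> S2 \<subseteq> D 2)) = incl S1 * incl S2"
proof -
  let ?S = "\<lambda>j::nat. if j = 1 then S1 else S2"
  have "E (\<lambda>D. of_bool (S1 \<subseteq> D 1 \<and> S2 \<subseteq> D 2)) = E (\<lambda>D. of_bool (\<forall>j\<in>{1,2}. D j \<in> {A. ?S j \<subseteq> A}))"
    by simp
  also have "\<dots> = incl S1 * incl S2"
    using n by (subst E_ball) (auto simp: incl_def)
  finally show ?thesis .
qed

lemma E_incl3:
  assumes "k \<in> K"
  shows "E (\<lambda>D. of_bool (S1 \<subseteq> D 1 \<and> S2 \<subseteq> D 2 \<and> S3 \<subseteq> D k)) = incl S1 * incl S2 * incl S3"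
proof -
  let ?S = "\<lambda>j::nat. if j = 1 then S1 else if j = 2 then S2 else S3"
  have "E (\<lambda>D. of_bool (S1 \<subseteq> D 1 \<and> S2 \<subseteq> D 2 \<and> S3 \<subseteq> D k)) = E (\<lambda>D. of_bool (\<forall>j\<in>{1,2,k}. D j \<in> {A. ?S j \<subseteq> A}))"
    using assms by (intro arg_cong[where f=E] ext) auto
  also have "\<dots> = incl S1 * incl S2 * incl S3"
    using assms by (subst E_ball) (auto simp: incl_def)
  finally show ?thesis .
qed

lemma E_incl4:
  assumes "k \<in> K" "l \<in> K" "k \<noteq> l"
  shows "E (\<lambda>D. of_bool (S1 \<subseteq> D 1 \<and> S2 \<subseteq> D 2 \<and> S3 \<subseteq> D k \<and> S4 \<subseteq> D l)) =
    incl S1 * incl S2 * incl S3 * incl S4"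
proof -
  let ?S = "\<lambda>j::nat. if j = 1 then S1 else if j = 2 then S2 else if j = k then S3 else S4"
  have "E (\<lambda>D. of_bool (S1 \<subseteq> D 1 \<and> S2 \<subseteq> D 2 \<and> S3 \<subseteq> D k \<and> S4 \<subseteq> D l)) =
      E (\<lambda>D. of_bool (\<forall>j\<in>{1,2,k,l}. D j \<in> {A. ?S j \<subseteq> A}))"
    using assms by (intro arg_cong[where f=E] ext) auto
  also have "\<dots> = incl S1 * incl S2 * incl S3 * incl S4"
    using assms by (subst E_ball) (auto simp: incl_def)
  finally show ?thesis .
qed

lemma E_sum: "E (\<lambda>D. \<Sum>i\<in>S. f i D :: real) = (\<Sum>i\<in>S. E (f i))"
  by (rule Bochner_Integration.integral_sum) simp

lemma incl_empty [simp]: "incl {} = 1"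
  by (simp add: incl_def)

section \<open>The first two factorial moments of the attribute set size\<close>

lemma E_card: "E (\<lambda>D. real (card (D 1))) = m * p1"
proof -
  \<comment> \<open>The void condition {} \<subseteq> D 2 gives the one-vertex event the shape of
    \<open>E_incl2\<close>, at the cost of a factor \<open>incl {} = 1\<close>.\<close>
  have "E (\<lambda>D. real (card (D 1))) = E (\<lambda>D. \<Sum>a\<in>M. of_bool ({a} \<subseteq> D 1 \<and> {} \<subseteq> D 2))"
    by (rule E_cong) (subst card_eq_sum_of_bool[of M], auto)
  also have "\<dots> = (\<Sum>a\<in>M. incl {a})"
    unfolding E_sum E_incl2 by simp
  also have "\<dots> = m * p1"
    by (simp add: incl_single)
  finally show ?thesis .
qed

lemma E_card_pairs: "E (\<lambda>D. real (card (D 1)) * (real (card (D 1)) - 1)) = m * (real m - 1) * p2"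
proof -
  have "E (\<lambda>D. real (card (D 1)) * (real (card (D 1)) - 1)) =
      E (\<lambda>D. \<Sum>a\<in>M. \<Sum>b\<in>M-{a}. of_bool ({a, b} \<subseteq> D 1 \<and> {} \<subseteq> D 2))"
    by (rule E_cong) (subst card_pairs_eq_sum_of_bool[of M], auto)
  also have "\<dots> = (\<Sum>a\<in>M. \<Sum>b\<in>M-{a}. incl {a, b})"
    unfolding E_sum E_incl2 by simp
  also have "\<dots> = (\<Sum>a\<in>M. \<Sum>b\<in>M-{a}. p2)"
    by (intro sum.cong refl incl_pair) auto
  also have "\<dots> = m * (real m - 1) * p2"
    using m by (simp add: of_nat_diff)
  finally show ?thesis .
qed

text \<open>The second factorial moment is at most E X_1^2, and m^2 \<le> 2 m (m - 1) because m
  \<ge> 2; hence the factor 2.\<close>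

lemma p2_le: "m\<^sup>2 * p2 \<le> 2 * E (\<lambda>D. (real (card (D 1)))\<^sup>2)"
proof -
  have "m * (real m - 1) * p2 \<le> E (\<lambda>D. (real (card (D 1)))\<^sup>2)"
    unfolding E_card_pairs[symmetric] by (rule E_mono) (simp add: power2_eq_square algebra_simps)
  moreover have "m\<^sup>2 * p2 \<le> 2 * (m * (real m - 1)) * p2"
    using m p_nonneg by (intro mult_right_mono) (auto simp: power2_eq_square algebra_simps)
  ultimately show ?thesis by simp
qed

section \<open>Shared attributes and common neighbours of vertices 1 and 2\<close>

definition "linked D \<longleftrightarrow> D 1 \<inter> D 2 \<noteq> {}" for D :: "nat \<Rightarrow> nat set"
definition "common D k \<longleftrightarrow> D 1 \<inter> D k \<noteq> {} \<and> D 2 \<inter> D k \<noteq> {}" for D :: "nat \<Rightarrow> nat set" and k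
text \<open>Vertices 1 and 2 are not adjacent to themselves, so they are never common neighbours.
  Restricting to \<open>K\<close> removes them and lets \<open>common\<close> omit the distinctness
  conditions of \<open>adjacent\<close>.\<close>

definition "deg D = card {k \<in> K. common D k}"

lemma finite_D: "\<forall>i. D i \<subseteq> M \<Longrightarrow> finite (D i :: nat set)"
  by (meson finite_subset finite_atLeastAtMost)

text \<open>First and second moment bounds for the number of shared attributes: a given attribute is
  shared with probability p1^2, a given pair with probability p2^2.\<close>

lemma prob_linked:
  "E (\<lambda>D. of_bool (linked D)) \<le> m * p1\<^sup>2"
  "m * p1\<^sup>2 - m\<^sup>2 * p2\<^sup>2 \<le> E (\<lambda>D. of_bool (linked D))"
proof -
  let ?f = "\<lambda>D :: nat \<Rightarrow> nat set. \<Sum>a\<in>M. of_bool ({a} \<subseteq> D 1 \<and> {a} \<subseteq> D 2) :: real"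
  let ?g = "\<lambda>D :: nat \<Rightarrow> nat set. \<Sum>a\<in>M. \<Sum>b\<in>M-{a}. of_bool ({a, b} \<subseteq> D 1 \<and> {a, b} \<subseteq> D 2) :: real"
  have f: "?f D = real (card (D 1 \<inter> D 2))" if "\<forall>i. D i \<subseteq> M" for D
    by (subst card_eq_sum_of_bool[of M]) (use that in auto)
  have g: "?g D = real (card (D 1 \<inter> D 2)) * (real (card (D 1 \<inter> D 2)) - 1)" if "\<forall>i. D i \<subseteq> M" for D
    by (subst card_pairs_eq_sum_of_bool[of M]) (use that in \<open>auto intro!: sum.cong arg_cong[where f=card]\<close>)
  have Ef: "E ?f = m * p1\<^sup>2"
    unfolding E_sum E_incl2 by (simp add: incl_single power2_eq_square)
  have "E ?g = (\<Sum>a\<in>M. \<Sum>b\<in>M-{a}. p2\<^sup>2)"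
    unfolding E_sum E_incl2 by (intro sum.cong refl) (simp add: incl_pair power2_eq_square)
  also have "\<dots> \<le> m\<^sup>2 * p2\<^sup>2"
    using m by (simp add: power2_eq_square of_nat_diff mult_right_mono)
  finally have Eg: "E ?g \<le> m\<^sup>2 * p2\<^sup>2" .
  have "E (\<lambda>D. of_bool (linked D)) \<le> E ?f"
  proof (rule E_mono)
    fix D :: "nat \<Rightarrow> nat set" assume D: "\<forall>i. D i \<subseteq> M"
    show "of_bool (linked D) \<le> ?f D"
      unfolding f[OF D] linked_def by (rule card_nonempty_bounds) (simp add: finite_D[OF D])
  qed
  then show "E (\<lambda>D. of_bool (linked D)) \<le> m * p1\<^sup>2" by (simp only: Ef)
  have "E ?f - E ?g = E (\<lambda>D. ?f D - ?g D)"
    by (rule Bochner_Integration.integral_diff[symmetric]) simp_all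
  also have "\<dots> \<le> E (\<lambda>D. of_bool (linked D))"
  proof (rule E_mono)
    fix D :: "nat \<Rightarrow> nat set" assume D: "\<forall>i. D i \<subseteq> M"
    show "?f D - ?g D \<le> of_bool (linked D)"
      unfolding f[OF D] g[OF D] linked_def by (rule card_nonempty_bounds) (simp add: finite_D[OF D])
  qed
  finally show "m * p1\<^sup>2 - m\<^sup>2 * p2\<^sup>2 \<le> E (\<lambda>D. of_bool (linked D))"
    using Ef Eg by linarith
qed

text \<open>The vertices hold a fixed \<open>w\<close> independently with probability
  \<open>p1\<close>, so the number of holders among the n - 2 vertices of \<open>K\<close> is
  exactly binomial and independent of vertices 1 and 2.\<close>

lemma prob_shared_binomial:
  assumes w: "w \<in> M"
  shows "E (\<lambda>D. of_bool (w \<in> D 1 \<and> w \<in> D 2 \<and> card {k \<in> K. w \<in> D k} = r)) =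
    p1\<^sup>2 * (real ((n - 2) choose r) * p1 ^ r * (1 - p1) ^ (n - 2 - r))"
proof -
  define \<R> where "\<R> = {R. R \<subseteq> K \<and> card R = r}"
  have fin: "finite \<R>" unfolding \<R>_def by (rule finite_subset[of _ "Pow K"]) auto
  have cardR: "card \<R> = (n - 2) choose r"
    unfolding \<R>_def using n by (subst n_subsets) (auto simp: numeral_eq_Suc)
  let ?B = "\<lambda>R j. if j = 1 \<or> j = 2 \<or> j \<in> R then {A. w \<in> A} else {A. w \<notin> A}"
  let ?q = "\<lambda>B. measure_pmf.prob (attribute_set m P) B"
  have in_n: "{1..n} = insert 1 (insert 2 K)" using n by auto
  have q1: "?q {A. w \<in> A} = p1"
    using incl_single[OF w] by (simp add: incl_def)
  have q2: "?q {A. w \<notin> A} = 1 - p1"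
    using measure_pmf.prob_compl[of "{A. w \<in> A}" "attribute_set m P"] q1
    by (simp add: Compl_eq_Diff_UNIV[symmetric] Collect_neg_eq)
  \<comment> \<open>The event is split by the exact set \<open>R\<close> of holders in
    \<open>K\<close>; each piece is a product event over all n vertices.\<close>
  have "of_bool (w \<in> D 1 \<and> w \<in> D 2 \<and> card {k \<in> K. w \<in> D k} = r) =
      (\<Sum>R\<in>\<R>. of_bool (\<forall>j\<in>{1..n}. D j \<in> ?B R j) :: real)" for D
  proof -
    have *: "(\<forall>j\<in>{1..n}. D j \<in> ?B R j) \<longleftrightarrow> w \<in> D 1 \<and> w \<in> D 2 \<and> R = {k \<in> K. w \<in> D k}" if "R \<in> \<R>" for R
    proof -
      have "(\<forall>j\<in>{1..n}. D j \<in> ?B R j) \<longleftrightarrow> w \<in> D 1 \<and> w \<in> D 2 \<and> (\<forall>k\<in>K. k \<in> R \<longleftrightarrow> w \<in> D k)"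
        unfolding in_n by auto
      moreover have "(\<forall>k\<in>K. k \<in> R \<longleftrightarrow> w \<in> D k) \<longleftrightarrow> R = {k \<in> K. w \<in> D k}"
        using that unfolding \<R>_def by blast
      ultimately show ?thesis by simp
    qed
    have "(\<Sum>R\<in>\<R>. of_bool (\<forall>j\<in>{1..n}. D j \<in> ?B R j) :: real) =
        (\<Sum>R\<in>\<R>. if R = {k \<in> K. w \<in> D k} then of_bool (w \<in> D 1 \<and> w \<in> D 2) else 0)"
      by (intro sum.cong refl) (simp only: *, simp)
    also have "\<dots> = of_bool (w \<in> D 1 \<and> w \<in> D 2 \<and> card {k \<in> K. w \<in> D k} = r)"
      unfolding sum.delta[OF fin] by (auto simp: \<R>_def)
    finally show ?thesis by simp
  qed
  then have "E (\<lambda>D. of_bool (w \<in> D 1 \<and> w \<in> D 2 \<and> card {k \<in> K. w \<in> D k} = r)) =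
      (\<Sum>R\<in>\<R>. \<Prod>j\<in>{1..n}. ?q (?B R j))"
    by (simp only: E_sum E_ball[OF order_refl])
  also have "\<dots> = (\<Sum>R\<in>\<R>. p1\<^sup>2 * (p1 ^ r * (1 - p1) ^ (n - 2 - r)))"
  proof (intro sum.cong refl)
    fix R assume R: "R \<in> \<R>"
    then have R': "R \<subseteq> K" "finite R" "card R = r" by (auto simp: \<R>_def intro: finite_subset)
    have "(\<Prod>j\<in>{1..n}. ?q (?B R j)) = p1\<^sup>2 * (\<Prod>j\<in>K. if j \<in> R then p1 else 1 - p1)"
    proof -
      have "(\<Prod>j\<in>K. ?q (?B R j)) = (\<Prod>j\<in>K. if j \<in> R then p1 else 1 - p1)"
        by (intro prod.cong refl) (auto simp: q1 q2)
      then show ?thesis unfolding in_n by (simp add: q1 power2_eq_square)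
    qed
    also have "(\<Prod>j\<in>K. if j \<in> R then p1 else 1 - p1) = p1 ^ card (K \<inter> R) * (1 - p1) ^ card (K - R)"
      by (subst prod.If_cases) (auto simp: Diff_eq Int_def)
    also have "K \<inter> R = R" using R' by auto
    also have "card (K - R) = n - 2 - r"
      using R' n by (simp add: card_Diff_subset numeral_eq_Suc)
    finally show "(\<Prod>j\<in>{1..n}. ?q (?B R j)) = p1\<^sup>2 * (p1 ^ r * (1 - p1) ^ (n - 2 - r))"
      using R' by simp
  qed
  also have "\<dots> = p1\<^sup>2 * (real ((n - 2) choose r) * p1 ^ r * (1 - p1) ^ (n - 2 - r))"
    by (simp add: cardR)
  finally show ?thesis .
qed

section \<open>Joint events with one or two common neighbours\<close>

lemma real_deg: "real (deg D) = (\<Sum>k\<in>K. of_bool (common D k))"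
  unfolding deg_def by (subst card_eq_sum_of_bool[of K]) auto

lemma sum_incl_pair:
  assumes "a \<in> M"
  shows "(\<Sum>b\<in>M. incl {a, b}) = p1 + (real m - 1) * p2"
proof -
  have "(\<Sum>b\<in>M. incl {a, b}) = incl {a, a} + (\<Sum>b\<in>M - {a}. incl {a, b})"
    using assms by (simp add: sum.remove)
  also have "(\<Sum>b\<in>M - {a}. incl {a, b}) = (\<Sum>b\<in>M - {a}. p2)"
    using assms by (intro sum.cong refl incl_pair) auto
  also have "\<dots> = (real m - 1) * p2"
    using assms m by (simp add: of_nat_diff)
  finally show ?thesis using incl_single[OF assms] by simp
qed

text \<open>Union bound over an attribute \<open>a\<close> shared by vertices 1 and k and an
  attribute \<open>b\<close> shared by 2 and k. The diagonal a = b gives m p1^3; off the diagonal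
  \<open>D k\<close> must contain a pair, hence the factor \<open>p2\<close>.\<close>

lemma prob_common_le:
  assumes k: "k \<in> K"
  shows "E (\<lambda>D. of_bool (common D k)) \<le> m * p1 ^ 3 + m\<^sup>2 * p1\<^sup>2 * p2"
proof -
  have "E (\<lambda>D. of_bool (common D k)) \<le> (E (\<lambda>D. \<Sum>a\<in>M. \<Sum>b\<in>M. of_bool ({a} \<subseteq> D 1 \<and> {b} \<subseteq> D 2 \<and> {a, b} \<subseteq> D k)) :: real)"
  proof (rule E_mono)
    fix D :: "nat \<Rightarrow> nat set" assume D: "\<forall>i. D i \<subseteq> M"
    show "of_bool (common D k) \<le> (\<Sum>a\<in>M. \<Sum>b\<in>M. of_bool ({a} \<subseteq> D 1 \<and> {b} \<subseteq> D 2 \<and> {a, b} \<subseteq> D k) :: real)"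
      unfolding sum.cartesian_product
    proof (rule of_bool_le_sum)
      assume "common D k"
      then obtain a b where ab: "a \<in> D 1" "a \<in> D k" "b \<in> D 2" "b \<in> D k" by (auto simp: common_def)
      with D have "a \<in> M" "b \<in> M" by blast+
      with ab show "\<exists>i\<in>M \<times> M. (case i of (a, b) \<Rightarrow> of_bool ({a} \<subseteq> D 1 \<and> {b} \<subseteq> D 2 \<and> {a, b} \<subseteq> D k)) \<ge> (1::real)"
        by (intro bexI[of _ "(a, b)"]) auto
    qed auto
  qed
  also have "\<dots> = (\<Sum>a\<in>M. p1\<^sup>2 * (\<Sum>b\<in>M. incl {a, b}))"
    unfolding E_sum E_incl3[OF k] sum_distrib_left
    by (intro sum.cong refl) (simp add: incl_single power2_eq_square)
  also have "\<dots> = (\<Sum>a\<in>M. p1\<^sup>2 * (p1 + (real m - 1) * p2))"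
    by (intro sum.cong refl) (simp only: sum_incl_pair)
  also have "\<dots> = m * p1\<^sup>2 * (p1 + (real m - 1) * p2)"
    by simp
  also have "\<dots> \<le> m * p1\<^sup>2 * (p1 + real m * p2)"
    using p_nonneg by (intro mult_left_mono add_left_mono mult_right_mono) auto
  finally show ?thesis by (simp add: algebra_simps power2_eq_square power3_eq_cube)
qed

text \<open>Swapping vertices 3 and k preserves the i.i.d. law and fixes vertices 1 and 2.\<close>

lemma prob_common_exchange:
  assumes k: "k \<in> K"
  shows "E (\<lambda>D. of_bool (common D k \<and> \<not> linked D)) = (E (\<lambda>D. of_bool (common D 3 \<and> \<not> linked D)) :: real)"
proof -
  let ?h = "Transposition.transpose 3 k"
  have bij: "bij_betw ?h {1..n} {1..n}"
    using k n by (intro bij_betw_transpose_iff) auto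
  have "G = map_pmf (\<lambda>D. D \<circ> ?h) G"
    unfolding active_rig_def using k n
    by (intro Pi_pmf_bij_betw bij) (auto simp: transpose_def)
  then have "E (\<lambda>D. of_bool (common D 3 \<and> \<not> linked D)) =
      (measure_pmf.expectation (map_pmf (\<lambda>D. D \<circ> ?h) G) (\<lambda>D. of_bool (common D 3 \<and> \<not> linked D)) :: real)"
    by simp
  also have "\<dots> = E (\<lambda>D. of_bool (common D k \<and> \<not> linked D))"
    unfolding integral_map_pmf using k by (simp add: common_def linked_def transpose_def)
  finally show ?thesis by simp
qed

text \<open>The main contribution is one attribute held by all three vertices. Failing that, the
  three edges need three different attributes and each vertex holds the two of its edges, whence m^3
  p2^3. The lower bound subtracts ordered pairs in the triple intersection.\<close>

lemma prob_triangle: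
  "E (\<lambda>D. of_bool (common D 3 \<and> linked D)) \<le> m * p1 ^ 3 + m ^ 3 * p2 ^ 3"
  "m * p1 ^ 3 - m ^ 2 * p2 ^ 3 \<le> E (\<lambda>D. of_bool (common D 3 \<and> linked D))"
proof -
  have 3: "3 \<in> K" using n by simp
  let ?f = "\<lambda>D :: nat \<Rightarrow> nat set. \<Sum>a\<in>M. of_bool ({a} \<subseteq> D 1 \<and> {a} \<subseteq> D 2 \<and> {a} \<subseteq> D 3) :: real"
  let ?g = "\<lambda>D :: nat \<Rightarrow> nat set. \<Sum>a\<in>M. \<Sum>b\<in>M-{a}. of_bool ({a, b} \<subseteq> D 1 \<and> {a, b} \<subseteq> D 2 \<and> {a, b} \<subseteq> D 3) :: real"
  let ?h = "\<lambda>D :: nat \<Rightarrow> nat set. \<Sum>a\<in>M. \<Sum>b\<in>M-{a}. \<Sum>c\<in>M-{a,b}.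
      of_bool ({a, c} \<subseteq> D 1 \<and> {b, c} \<subseteq> D 2 \<and> {a, b} \<subseteq> D 3) :: real"
  let ?I = "\<lambda>D :: nat \<Rightarrow> nat set. D 1 \<inter> D 2 \<inter> D 3"
  have f: "?f D = real (card (?I D))" if "\<forall>i. D i \<subseteq> M" for D
    by (subst card_eq_sum_of_bool[of M]) (use that in \<open>auto intro!: arg_cong[where f=card]\<close>)
  have g: "?g D = real (card (?I D)) * (real (card (?I D)) - 1)" if "\<forall>i. D i \<subseteq> M" for D
    by (subst card_pairs_eq_sum_of_bool[of M]) (use that in \<open>auto intro!: sum.cong arg_cong[where f=card]\<close>)
  have Ef: "E ?f = m * p1 ^ 3"
    unfolding E_sum E_incl3[OF 3] by (simp add: incl_single power3_eq_cube)
  have "E ?g = (\<Sum>a\<in>M. \<Sum>b\<in>M-{a}. p2 ^ 3)"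
    unfolding E_sum E_incl3[OF 3] by (intro sum.cong refl) (simp add: incl_pair power3_eq_cube)
  also have "\<dots> \<le> (\<Sum>a\<in>M. \<Sum>b\<in>M. p2 ^ 3)"
    using p_nonneg by (intro sum_mono sum_mono2) auto
  finally have Eg: "E ?g \<le> m\<^sup>2 * p2 ^ 3" by (simp add: power2_eq_square)
  have "E ?h = (\<Sum>a\<in>M. \<Sum>b\<in>M-{a}. \<Sum>c\<in>M-{a,b}. p2 ^ 3)"
    unfolding E_sum E_incl3[OF 3] by (intro sum.cong refl) (simp add: incl_pair power3_eq_cube)
  also have "\<dots> \<le> (\<Sum>a\<in>M. \<Sum>b\<in>M. \<Sum>c\<in>M-{a,b}. p2 ^ 3)"
    using p_nonneg by (intro sum_mono sum_mono2) (auto intro!: sum_nonneg)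
  also have "\<dots> \<le> (\<Sum>a\<in>M. \<Sum>b\<in>M. \<Sum>c\<in>M. p2 ^ 3)"
    using p_nonneg by (intro sum_mono sum_mono2) auto
  finally have Eh: "E ?h \<le> m ^ 3 * p2 ^ 3" by (simp add: power3_eq_cube)
  have "E (\<lambda>D. of_bool (common D 3 \<and> linked D)) \<le> E (\<lambda>D. ?f D + ?h D)"
  proof (rule E_mono)
    fix D :: "nat \<Rightarrow> nat set" assume D: "\<forall>i. D i \<subseteq> M"
    have h0: "?h D \<ge> 0" by (intro sum_nonneg) auto
    show "of_bool (common D 3 \<and> linked D) \<le> ?f D + ?h D"
    proof (cases "common D 3 \<and> linked D \<and> ?I D = {}")
      case True
      then obtain a b c where abc: "a \<in> D 1" "a \<in> D 3" "b \<in> D 2" "b \<in> D 3" "c \<in> D 1" "c \<in> D 2"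
        by (auto simp: common_def linked_def)
      \<comment> \<open>If two of \<open>a\<close>, \<open>b\<close>, \<open>c\<close> coincided,
        that attribute would belong to all three vertices.\<close>
      with True have ne: "a \<noteq> b" "a \<noteq> c" "b \<noteq> c" by auto
      have M: "a \<in> M" "b \<in> M" "c \<in> M" using abc D by blast+
      have "1 \<le> (\<Sum>c\<in>M-{a,b}. of_bool ({a, c} \<subseteq> D 1 \<and> {b, c} \<subseteq> D 2 \<and> {a, b} \<subseteq> D 3) :: real)"
        using member_le_sum[of c "M-{a,b}" "\<lambda>c. of_bool ({a, c} \<subseteq> D 1 \<and> {b, c} \<subseteq> D 2 \<and> {a, b} \<subseteq> D 3) :: real"]
          abc ne M by simp
      also have "\<dots> \<le> (\<Sum>b\<in>M-{a}. \<Sum>c\<in>M-{a,b}. of_bool ({a, c} \<subseteq> D 1 \<and> {b, c} \<subseteq> D 2 \<and> {a, b} \<subseteq> D 3))"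
        using ne M by (intro member_le_sum[of b]) (auto intro!: sum_nonneg)
      also have "\<dots> \<le> ?h D"
        using M by (intro member_le_sum[of a]) (auto intro!: sum_nonneg)
      finally have "1 \<le> ?h D" .
      moreover have "?f D \<ge> 0" by (intro sum_nonneg) auto
      ultimately show ?thesis using True by simp
    next
      case False
      have "of_bool (common D 3 \<and> linked D) \<le> (of_bool (?I D \<noteq> {}) :: real)"
        using False by auto
      also have "\<dots> \<le> real (card (?I D))"
        by (rule card_nonempty_bounds) (simp add: finite_D[OF D])
      finally show ?thesis using f[OF D] h0 by linarith
    qed
  qed
  also have "\<dots> = E ?f + E ?h"
    by (rule Bochner_Integration.integral_add) simp_all
  finally show "E (\<lambda>D. of_bool (common D 3 \<and> linked D)) \<le> m * p1 ^ 3 + m ^ 3 * p2 ^ 3"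
    using Ef Eh by linarith
  have "E ?f - E ?g = E (\<lambda>D. ?f D - ?g D)"
    by (rule Bochner_Integration.integral_diff[symmetric]) simp_all
  also have "\<dots> \<le> E (\<lambda>D. of_bool (common D 3 \<and> linked D))"
  proof (rule E_mono)
    fix D :: "nat \<Rightarrow> nat set" assume D: "\<forall>i. D i \<subseteq> M"
    have "?f D - ?g D \<le> of_bool (?I D \<noteq> {})"
      unfolding f[OF D] g[OF D] by (rule card_nonempty_bounds) (simp add: finite_D[OF D])
    also have "\<dots> \<le> (of_bool (common D 3 \<and> linked D) :: real)"
      by (auto simp: common_def linked_def)
    finally show "?f D - ?g D \<le> of_bool (common D 3 \<and> linked D)" .
  qed
  finally show "m * p1 ^ 3 - m ^ 2 * p2 ^ 3 \<le> E (\<lambda>D. of_bool (common D 3 \<and> linked D))"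
    using Ef Eg by linarith
qed

text \<open>Two common neighbours k, l of a non-adjacent pair use attributes a, b and c, d with {a,
  c} \<subseteq> D 1 and {b, d} \<subseteq> D 2. Nothing is shared, so a \<noteq> b and c \<noteq>
  d, and \<open>D k\<close>, \<open>D l\<close> each contain a pair: this gives p2^2. As a = c and b
  = d stay possible, vertices 1 and 2 each contribute the full double sum of
  \<open>incl {a, c}\<close>, diagonal included.\<close>

lemma E_deg_pairs_le:
  "E (\<lambda>D. of_bool (\<not> linked D) * (real (deg D) * (real (deg D) - 1))) \<le> n\<^sup>2 * (m * p1 + m\<^sup>2 * p2)\<^sup>2 * p2\<^sup>2"
proof -
  define Q where "Q = (\<lambda>k l (D :: nat \<Rightarrow> nat set) a b c d. of_bool ({a, c} \<subseteq> D 1 \<and> {b, d} \<subseteq> D 2 \<and> {a, b} \<subseteq> D k \<and> {c, d} \<subseteq> D l) :: real)"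
  define F where "F = (\<lambda>k l (D :: nat \<Rightarrow> nat set). \<Sum>a\<in>M. \<Sum>b\<in>M - {a}. \<Sum>c\<in>M. \<Sum>d\<in>M - {c}. Q k l D a b c d)"
  have F_nonneg: "F k l D \<ge> 0" for k l D
    unfolding F_def Q_def by (intro sum_nonneg) auto
  have sum_all: "(\<Sum>a\<in>M. \<Sum>c\<in>M. incl {a, c}) \<le> m * p1 + m\<^sup>2 * p2"
  proof -
    have "(\<Sum>a\<in>M. \<Sum>c\<in>M. incl {a, c}) = (\<Sum>a\<in>M. p1 + (real m - 1) * p2)"
      by (intro sum.cong refl sum_incl_pair)
    also have "\<dots> = m * p1 + m * (real m - 1) * p2" by (simp add: algebra_simps)
    also have "\<dots> \<le> m * p1 + m * real m * p2"
      using p_nonneg by (intro add_left_mono mult_right_mono mult_left_mono) auto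
    finally show ?thesis by (simp add: power2_eq_square)
  qed
  have incl_nonneg: "incl S \<ge> 0" for S by (simp add: incl_def)
  have EF: "E (F k l) \<le> p2\<^sup>2 * (m * p1 + m\<^sup>2 * p2)\<^sup>2" if kl: "k \<in> K" "l \<in> K" "k \<noteq> l" for k l
  proof -
    have "E (F k l) = (\<Sum>a\<in>M. \<Sum>b\<in>M - {a}. \<Sum>c\<in>M. \<Sum>d\<in>M - {c}. incl {a, c} * incl {b, d} * p2\<^sup>2)"
      unfolding F_def Q_def E_sum E_incl4[OF kl]
      by (intro sum.cong refl) (simp add: incl_pair power2_eq_square)
    also have "\<dots> \<le> (\<Sum>a\<in>M. \<Sum>b\<in>M. \<Sum>c\<in>M. \<Sum>d\<in>M - {c}. incl {a, c} * incl {b, d} * p2\<^sup>2)"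
      by (intro sum_mono sum_mono2) (auto intro!: sum_nonneg mult_nonneg_nonneg incl_nonneg)
    also have "\<dots> \<le> (\<Sum>a\<in>M. \<Sum>b\<in>M. \<Sum>c\<in>M. \<Sum>d\<in>M. incl {a, c} * incl {b, d} * p2\<^sup>2)"
      by (intro sum_mono sum_mono2) (auto intro!: sum_nonneg mult_nonneg_nonneg incl_nonneg)
    \<comment> \<open>Exchanging the sums over b and c separates an (a, c) factor from a (b, d)
      factor.\<close>
    also have "\<dots> = (\<Sum>a\<in>M. \<Sum>c\<in>M. \<Sum>b\<in>M. \<Sum>d\<in>M. incl {a, c} * incl {b, d} * p2\<^sup>2)"
      by (intro sum.cong refl sum.swap)
    also have "\<dots> = (\<Sum>a\<in>M. \<Sum>c\<in>M. incl {a, c} * ((\<Sum>b\<in>M. \<Sum>d\<in>M. incl {b, d}) * p2\<^sup>2))"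
      by (simp add: sum_distrib_left sum_distrib_right mult.assoc)
    also have "\<dots> = (\<Sum>a\<in>M. \<Sum>c\<in>M. incl {a, c}) * (\<Sum>b\<in>M. \<Sum>d\<in>M. incl {b, d}) * p2\<^sup>2"
      by (simp only: sum_distrib_right[symmetric] mult.assoc)
    also have "\<dots> \<le> (m * p1 + m\<^sup>2 * p2) * (m * p1 + m\<^sup>2 * p2) * p2\<^sup>2"
      using p_nonneg by (intro mult_right_mono mult_mono sum_all sum_nonneg incl_nonneg) auto
    finally show ?thesis by (simp add: power2_eq_square mult_ac)
  qed
  have "E (\<lambda>D. of_bool (\<not> linked D) * (real (deg D) * (real (deg D) - 1))) \<le> E (\<lambda>D. \<Sum>k\<in>K. \<Sum>l\<in>K - {k}. F k l D)"
  proof (rule E_mono)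
    fix D :: "nat \<Rightarrow> nat set" assume D: "\<forall>i. D i \<subseteq> M"
    show "of_bool (\<not> linked D) * (real (deg D) * (real (deg D) - 1)) \<le> (\<Sum>k\<in>K. \<Sum>l\<in>K - {k}. F k l D)"
    proof (cases "linked D")
      case True
      then show ?thesis by (simp add: sum_nonneg F_nonneg)
    next
      case False
      have "real (deg D) * (real (deg D) - 1) = (\<Sum>k\<in>K. \<Sum>l\<in>K - {k}. of_bool (common D k \<and> common D l))"
        unfolding deg_def by (subst card_pairs_eq_sum_of_bool[of K]) (auto intro!: sum.cong arg_cong[where f=card])
      also have "\<dots> \<le> (\<Sum>k\<in>K. \<Sum>l\<in>K - {k}. F k l D)"
      proof (intro sum_mono)
        fix k l
        show "of_bool (common D k \<and> common D l) \<le> F k l D"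
        proof (cases "common D k \<and> common D l")
          case True
          then obtain a b c d where abcd: "a \<in> D 1" "a \<in> D k" "b \<in> D 2" "b \<in> D k"
              "c \<in> D 1" "c \<in> D l" "d \<in> D 2" "d \<in> D l"
            by (auto simp: common_def)
          with D have M: "a \<in> M" "b \<in> M" "c \<in> M" "d \<in> M" by blast+
          have ne: "a \<noteq> b" "c \<noteq> d" using abcd False by (auto simp: linked_def)
          have Q0: "Q k l D a b c d \<ge> 0" for a b c d by (simp add: Q_def)
          have "1 = Q k l D a b c d" using abcd by (simp add: Q_def)
          also have "\<dots> \<le> (\<Sum>d\<in>M - {c}. Q k l D a b c d)"
            using M ne by (intro member_le_sum[of d]) (auto simp: Q0)
          also have "\<dots> \<le> (\<Sum>c\<in>M. \<Sum>d\<in>M - {c}. Q k l D a b c d)"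
            using M ne by (intro member_le_sum[of c]) (auto simp: Q0 intro!: sum_nonneg)
          also have "\<dots> \<le> (\<Sum>b\<in>M - {a}. \<Sum>c\<in>M. \<Sum>d\<in>M - {c}. Q k l D a b c d)"
            using M ne by (intro member_le_sum[of b]) (auto simp: Q0 intro!: sum_nonneg)
          also have "\<dots> \<le> F k l D"
            unfolding F_def using M ne by (intro member_le_sum[of a]) (auto simp: Q0 intro!: sum_nonneg)
          finally show ?thesis using True by simp
        next
          case False
          then show ?thesis using F_nonneg[of k l D] by auto
        qed
      qed
      finally show ?thesis using False by simp
    qed
  qed
  also have "\<dots> = (\<Sum>k\<in>K. \<Sum>l\<in>K - {k}. E (F k l))"
    by (simp only: E_sum)
  also have "\<dots> \<le> (\<Sum>k\<in>K. \<Sum>l\<in>K - {k}. p2\<^sup>2 * (m * p1 + m\<^sup>2 * p2)\<^sup>2)"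
    by (intro sum_mono EF) auto
  also have "\<dots> \<le> (\<Sum>k\<in>{1..n}. \<Sum>l\<in>{1..n}. p2\<^sup>2 * (m * p1 + m\<^sup>2 * p2)\<^sup>2)"
    by (intro order_trans[OF sum_mono sum_mono2] sum_mono2) (auto intro!: sum_nonneg)
  also have "\<dots> = n\<^sup>2 * (m * p1 + m\<^sup>2 * p2)\<^sup>2 * p2\<^sup>2"
    by (simp add: power2_eq_square)
  finally show ?thesis .
qed

text \<open>\<open>?f\<close> counts the shared attributes with exactly r further holders; its mean
  is the binomial term. It can differ from the event only if two attributes are shared
  (\<open>?g\<close>), or if a common neighbour k avoids the single shared one and so meets
  \<open>D 1\<close> and \<open>D 2\<close> in different attributes (\<open>?h\<close>).\<close>

lemma prob_linked_deg:
  "\<bar>E (\<lambda>D. of_bool (linked D \<and> deg D = r)) - m * (p1\<^sup>2 * (real ((n - 2) choose r) * p1 ^ r * (1 - p1) ^ (n - 2 - r)))\<bar>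
    \<le> m\<^sup>2 * p2\<^sup>2 + n * m\<^sup>2 * p2 * (2 * p1 * p2 + m * p2\<^sup>2)"
proof -
  let ?N = "\<lambda>(D :: nat \<Rightarrow> nat set) w. card {k \<in> K. w \<in> D k}"
  let ?f = "\<lambda>D. \<Sum>w\<in>M. of_bool (w \<in> D 1 \<and> w \<in> D 2 \<and> ?N D w = r) :: real"
  let ?g = "\<lambda>D :: nat \<Rightarrow> nat set. \<Sum>a\<in>M. \<Sum>b\<in>M-{a}. of_bool ({a, b} \<subseteq> D 1 \<and> {a, b} \<subseteq> D 2) :: real"
  let ?h = "\<lambda>D :: nat \<Rightarrow> nat set. \<Sum>k\<in>K. \<Sum>a\<in>M. \<Sum>b\<in>M-{a}. \<Sum>w\<in>M. of_bool ({a, w} \<subseteq> D 1 \<and> {b, w} \<subseteq> D 2 \<and> {a, b} \<subseteq> D k) :: real"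
  let ?I = "\<lambda>D :: nat \<Rightarrow> nat set. D 1 \<inter> D 2"
  have g: "?g D = real (card (?I D)) * (real (card (?I D)) - 1)" if "\<forall>i. D i \<subseteq> M" for D
    by (subst card_pairs_eq_sum_of_bool[of M]) (use that in \<open>auto intro!: sum.cong arg_cong[where f=card]\<close>)
  have Ef: "E ?f = m * (p1\<^sup>2 * (real ((n - 2) choose r) * p1 ^ r * (1 - p1) ^ (n - 2 - r)))"
    unfolding E_sum by (simp only: prob_shared_binomial cong: sum.cong) simp
  have "E ?g = (\<Sum>a\<in>M. \<Sum>b\<in>M-{a}. p2\<^sup>2)"
    unfolding E_sum E_incl2 by (intro sum.cong refl) (simp add: incl_pair power2_eq_square)
  also have "\<dots> \<le> (\<Sum>a\<in>M. \<Sum>b\<in>M. p2\<^sup>2)"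
    by (intro sum_mono sum_mono2) auto
  finally have Eg: "E ?g \<le> m\<^sup>2 * p2\<^sup>2" by (simp add: power2_eq_square)
  have "E ?h = (\<Sum>k\<in>K. \<Sum>a\<in>M. \<Sum>b\<in>M-{a}. \<Sum>w\<in>M. incl {a, w} * incl {b, w} * p2)"
    unfolding E_sum by (intro sum.cong refl, subst E_incl3) (simp_all add: incl_pair)
  also have "\<dots> \<le> (\<Sum>k\<in>K. \<Sum>a\<in>M. \<Sum>b\<in>M-{a}. (2 * p1 * p2 + m * p2\<^sup>2) * p2)"
  proof (intro sum_mono)
    fix k a b assume ab: "a \<in> M" "b \<in> M - {a}"
    \<comment> \<open>For w = a or w = b one of the two pairs collapses to a single attribute and
      the product is p1 p2; otherwise it is p2^2.\<close>
    have "(\<Sum>w\<in>M. incl {a, w} * incl {b, w}) \<le>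
        (\<Sum>w\<in>M. (if w = a then p1 * p2 else 0) + (if w = b then p1 * p2 else 0) + p2\<^sup>2)"
    proof (rule sum_mono)
      fix w assume "w \<in> M"
      with ab have "w = a \<Longrightarrow> incl {a, w} * incl {b, w} = p1 * p2" "w = b \<Longrightarrow> incl {a, w} * incl {b, w} = p1 * p2"
        "w \<noteq> a \<Longrightarrow> w \<noteq> b \<Longrightarrow> incl {a, w} * incl {b, w} = p2\<^sup>2"
        by (auto simp: incl_pair incl_single power2_eq_square)
      then show "incl {a, w} * incl {b, w} \<le> (if w = a then p1 * p2 else 0) + (if w = b then p1 * p2 else 0) + p2\<^sup>2"
        using ab by (cases "w = a"; cases "w = b") auto
    qed
    also have "\<dots> = 2 * p1 * p2 + m * p2\<^sup>2"
      using ab by (simp add: sum.distrib)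
    finally show "(\<Sum>w\<in>M. incl {a, w} * incl {b, w} * p2) \<le> (2 * p1 * p2 + m * p2\<^sup>2) * p2"
      unfolding sum_distrib_right[symmetric] using p_nonneg by (intro mult_right_mono) auto
  qed
  also have "\<dots> \<le> (\<Sum>k\<in>{1..n}. \<Sum>a\<in>M. \<Sum>b\<in>M. (2 * p1 * p2 + m * p2\<^sup>2) * p2)"
    using p_nonneg by (intro order_trans[OF sum_mono sum_mono2] sum_mono sum_mono2) (auto intro!: sum_nonneg)
  also have "\<dots> = n * m\<^sup>2 * p2 * (2 * p1 * p2 + m * p2\<^sup>2)"
    by (simp add: power2_eq_square mult_ac)
  finally have Eh: "E ?h \<le> n * m\<^sup>2 * p2 * (2 * p1 * p2 + m * p2\<^sup>2)" .
  have key: "\<bar>of_bool (linked D \<and> deg D = r) - ?f D\<bar> \<le> ?g D + ?h D" if D: "\<forall>i. D i \<subseteq> M" for D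
  proof -
    have h0: "?h D \<ge> 0" by (intro sum_nonneg) auto
    have fin: "finite (?I D)" by (simp add: finite_D[OF D])
    have "?f D = (\<Sum>w\<in>M. of_bool (w \<in> ?I D) * of_bool (?N D w = r))"
      by (intro sum.cong) auto
    also have "\<dots> = (\<Sum>w\<in>?I D. of_bool (w \<in> ?I D) * of_bool (?N D w = r))"
      using D by (intro sum.mono_neutral_right) auto
    finally have f: "?f D = (\<Sum>w\<in>?I D. of_bool (?N D w = r))" by simp
    have f0: "?f D \<ge> 0" by (intro sum_nonneg) auto
    have f1: "?f D \<le> card (?I D)"
      unfolding f using sum_bounded_above[of "?I D" "\<lambda>w. of_bool (?N D w = r) :: real" 1] by auto
    consider "card (?I D) = 0" | "card (?I D) = 1" | "card (?I D) \<ge> 2" by linarith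
    then show ?thesis
    proof cases
      case 1
      then have "?I D = {}" using fin by simp
      then have "\<not> linked D" "?f D = 0" unfolding f by (auto simp: linked_def)
      then show ?thesis using h0 g[OF D] 1 by simp
    next
      case 2
      then obtain w where w: "?I D = {w}" by (rule card_1_singletonE)
      have fw: "?f D = of_bool (?N D w = r)" unfolding f w by simp
      have lk: "linked D" using w by (auto simp: linked_def)
      \<comment> \<open>Every holder of \<open>w\<close> in \<open>K\<close> is a common neighbour.
        A common neighbour without \<open>w\<close> yields a \<noteq> b: a single attribute in both
        roles would be shared, hence equal to \<open>w\<close>.\<close>
      have "deg D = ?N D w \<or> 1 \<le> ?h D"
      proof (cases "\<exists>k\<in>K. common D k \<and> w \<notin> D k")
        case False
        then have "{k \<in> K. common D k} = {k \<in> K. w \<in> D k}"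
          using w by (auto simp: common_def)
        then show ?thesis by (simp add: deg_def)
      next
        case True
        then obtain k where k: "k \<in> K" "common D k" "w \<notin> D k" by blast
        then obtain a b where ab: "a \<in> D 1" "a \<in> D k" "b \<in> D 2" "b \<in> D k"
          by (auto simp: common_def)
        have "a \<noteq> b"
        proof
          assume "a = b"
          then have "a \<in> ?I D" using ab by simp
          then have "a = w" unfolding w by simp
          then show False using ab k by simp
        qed
        have M: "a \<in> M" "b \<in> M" "w \<in> M" using ab w D by blast+
        have w12: "w \<in> D 1" "w \<in> D 2" using w by blast+
        let ?q = "\<lambda>k a b w. of_bool ({a, w} \<subseteq> D 1 \<and> {b, w} \<subseteq> D 2 \<and> {a, b} \<subseteq> D k) :: real"
        have "1 = ?q k a b w" using ab w12 by simp
        also have "\<dots> \<le> (\<Sum>w\<in>M. ?q k a b w)"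
          using M by (intro member_le_sum[of w]) auto
        also have "\<dots> \<le> (\<Sum>b\<in>M - {a}. \<Sum>w\<in>M. ?q k a b w)"
          using M \<open>a \<noteq> b\<close> by (intro member_le_sum[of b]) (auto intro!: sum_nonneg)
        also have "\<dots> \<le> (\<Sum>a\<in>M. \<Sum>b\<in>M - {a}. \<Sum>w\<in>M. ?q k a b w)"
          using M by (intro member_le_sum[of a]) (auto intro!: sum_nonneg)
        also have "\<dots> \<le> ?h D"
          using k by (intro member_le_sum[of k]) (auto intro!: sum_nonneg)
        finally show ?thesis by simp
      qed
      then show ?thesis
      proof
        assume "deg D = ?N D w"
        then have "\<bar>of_bool (linked D \<and> deg D = r) - ?f D\<bar> = 0" unfolding fw using lk by simp
        then show ?thesis using h0 g[OF D] 2 by simp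
      next
        assume h1: "1 \<le> ?h D"
        have "\<bar>of_bool (linked D \<and> deg D = r) - ?f D\<bar> \<le> 1" unfolding fw by simp
        then show ?thesis using h1 g[OF D] 2 by simp
      qed
    next
      case 3
      \<comment> \<open>Both quantities lie between 0 and the number c of shared attributes, and c
        \<le> c (c - 1) for c \<ge> 2, so \<open>?g\<close> alone covers the error.\<close>
      have "\<bar>of_bool (linked D \<and> deg D = r) - ?f D\<bar> \<le> card (?I D)"
        using f0 f1 3 by auto
      also have "\<dots> \<le> real (card (?I D)) * (real (card (?I D)) - 1)"
        using 3 mult_left_mono[of 1 "real (card (?I D)) - 1" "real (card (?I D))"] by simp
      finally show ?thesis using h0 g[OF D] by linarith
    qed
  qed
  let ?e = "\<lambda>D. of_bool (linked D \<and> deg D = r) :: real"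
  have "\<bar>E ?e - E ?f\<bar> = \<bar>E (\<lambda>D. ?e D - ?f D)\<bar>"
    by (subst Bochner_Integration.integral_diff) simp_all
  also have "\<dots> \<le> E (\<lambda>D. \<bar>?e D - ?f D\<bar>)"
    by (rule integral_abs_bound)
  also have "\<dots> \<le> E (\<lambda>D. ?g D + ?h D)"
    by (rule E_mono) (rule key)
  also have "\<dots> = E ?g + E ?h"
    by (rule Bochner_Integration.integral_add) simp_all
  finally show ?thesis using Ef Eg Eh by linarith
qed

text \<open>Pointwise d - d (d - 1) \<le> [d = 1] \<le> d for the number d of common neighbours;
  \<open>E_deg_pairs_le\<close> controls the subtracted term.\<close>

lemma prob_not_linked_deg_1:
  "E (\<lambda>D. of_bool (\<not> linked D \<and> deg D = 1)) \<le>
     (real n - 2) * E (\<lambda>D. of_bool (common D 3 \<and> \<not> linked D))"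
  "(real n - 2) * E (\<lambda>D. of_bool (common D 3 \<and> \<not> linked D)) - n\<^sup>2 * (m * p1 + m\<^sup>2 * p2)\<^sup>2 * p2\<^sup>2
    \<le> E (\<lambda>D. of_bool (\<not> linked D \<and> deg D = 1))"
proof -
  let ?f = "\<lambda>D. \<Sum>k\<in>K. of_bool (common D k \<and> \<not> linked D) :: real"
  let ?g = "\<lambda>D. of_bool (\<not> linked D) * (real (deg D) * (real (deg D) - 1))"
  have f: "?f D = of_bool (\<not> linked D) * real (deg D)" for D
    by (simp add: real_deg)
  have "E ?f = (\<Sum>k\<in>K. E (\<lambda>D. of_bool (common D 3 \<and> \<not> linked D)))"
    unfolding E_sum by (intro sum.cong refl prob_common_exchange)
  then have Ef: "E ?f = (real n - 2) * E (\<lambda>D. of_bool (common D 3 \<and> \<not> linked D))"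
    using n by (simp add: of_nat_diff numeral_eq_Suc)
  have "E (\<lambda>D. of_bool (\<not> linked D \<and> deg D = 1)) \<le> E ?f"
    by (rule E_mono) (simp add: f)
  then show "E (\<lambda>D. of_bool (\<not> linked D \<and> deg D = 1)) \<le>
     (real n - 2) * E (\<lambda>D. of_bool (common D 3 \<and> \<not> linked D))"
    by (simp only: Ef)
  have "E ?f - E ?g = E (\<lambda>D. ?f D - ?g D)"
    by (rule Bochner_Integration.integral_diff[symmetric]) simp_all
  also have "\<dots> \<le> E (\<lambda>D. of_bool (\<not> linked D \<and> deg D = 1))"
  proof (rule E_mono)
    fix D
    have "real d - real d * (real d - 1) \<le> of_bool (d = 1)" for d :: nat
    proof (cases "d \<ge> 2")
      case True
      then have "real d * 1 \<le> real d * (real d - 1)" by (intro mult_left_mono) auto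
      with True show ?thesis by simp
    next
      case False
      then have "d = 0 \<or> d = 1" by linarith
      then show ?thesis by auto
    qed
    from this[of "deg D"] show "?f D - ?g D \<le> of_bool (\<not> linked D \<and> deg D = 1)"
      unfolding f by (cases "linked D") simp_all
  qed
  finally show "(real n - 2) * E (\<lambda>D. of_bool (common D 3 \<and> \<not> linked D)) - n\<^sup>2 * (m * p1 + m\<^sup>2 * p2)\<^sup>2 * p2\<^sup>2
    \<le> E (\<lambda>D. of_bool (\<not> linked D \<and> deg D = 1))"
    using Ef E_deg_pairs_le by linarith
qed

text \<open>[d = r] \<le> d (d - 1) whenever r \<ge> 2, so one bound serves all these r.\<close>

lemma prob_not_linked_deg_ge_2:
  assumes "r \<ge> 2"
  shows "E (\<lambda>D. of_bool (\<not> linked D \<and> deg D = r)) \<le> n\<^sup>2 * (m * p1 + m\<^sup>2 * p2)\<^sup>2 * p2\<^sup>2"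
proof -
  have "E (\<lambda>D. of_bool (\<not> linked D \<and> deg D = r)) \<le> E (\<lambda>D. of_bool (\<not> linked D) * (real (deg D) * (real (deg D) - 1)))"
  proof (rule E_mono)
    fix D
    have "of_bool (deg D = r) \<le> real (deg D) * (real (deg D) - 1)"
    proof (cases "deg D = r")
      case True
      then have "1 * 1 \<le> real (deg D) * (real (deg D) - 1)" using assms by (intro mult_mono) auto
      with True show ?thesis by simp
    next
      case False
      then show ?thesis by (cases "deg D") auto
    qed
    then show "of_bool (\<not> linked D \<and> deg D = r) \<le> of_bool (\<not> linked D) * (real (deg D) * (real (deg D) - 1))"
      by (cases "linked D") simp_all
  qed
  then show ?thesis using E_deg_pairs_le by linarith
qed

text \<open>Serves the case r = 0: after passing to the limit the conditioning event has probability
  tending to 1.\<close>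

lemma prob_deg_pos_le:
  "E (\<lambda>D. of_bool (deg D \<noteq> 0)) \<le> n * (m * p1 ^ 3 + m\<^sup>2 * p1\<^sup>2 * p2)"
proof -
  have "E (\<lambda>D. of_bool (deg D \<noteq> 0)) \<le> E (\<lambda>D. \<Sum>k\<in>K. of_bool (common D k) :: real)"
    by (rule E_mono) (simp add: real_deg[symmetric])
  also have "\<dots> = (\<Sum>k\<in>K. E (\<lambda>D. of_bool (common D k)))" by (rule E_sum)
  also have "\<dots> \<le> (\<Sum>k\<in>K. m * p1 ^ 3 + m\<^sup>2 * p1\<^sup>2 * p2)"
    by (intro sum_mono prob_common_le)
  also have "\<dots> \<le> (\<Sum>k\<in>{1..n}. m * p1 ^ 3 + m\<^sup>2 * p1\<^sup>2 * p2)"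
    using p_nonneg by (intro sum_mono2) auto
  finally show ?thesis by simp
qed

section \<open>The graph quantities as expectations of indicators\<close>

lemma adjacent_eq_linked: "adjacent D 1 2 \<longleftrightarrow> linked D"
  by (simp add: adjacent_def linked_def)

lemma adjacent_eq_common: "adjacent D 1 3 \<and> adjacent D 2 3 \<longleftrightarrow> common D 3"
  by (simp add: adjacent_def common_def)

lemma common_neighbours_eq_deg: "common_neighbours n D 1 2 = deg D"
  unfolding common_neighbours_def deg_def adjacent_def common_def
  by (intro arg_cong[where f=card]) auto

text \<open>Splitting the conditioning event by adjacency brings both cl(r) and \<alpha> into the
  form x / (x + y).\<close>

lemma E_split: "E (\<lambda>D. of_bool (Q D)) = E (\<lambda>D. of_bool (linked D \<and> Q D)) + (E (\<lambda>D. of_bool (\<not> linked D \<and> Q D)) :: real)"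
proof -
  have "E (\<lambda>D. of_bool (Q D)) = E (\<lambda>D. of_bool (linked D \<and> Q D) + of_bool (\<not> linked D \<and> Q D) :: real)"
    by (rule E_cong) auto
  also have "\<dots> = E (\<lambda>D. of_bool (linked D \<and> Q D)) + E (\<lambda>D. of_bool (\<not> linked D \<and> Q D))"
    by (rule Bochner_Integration.integral_add) simp_all
  finally show ?thesis .
qed

lemma edge_probability_eq: "edge_probability n m P = E (\<lambda>D. of_bool (linked D))"
  unfolding edge_probability_def adjacent_eq_linked E_of_bool by simp

lemma clustering_function_eq:
  "clustering_function n m P r =
    E (\<lambda>D. of_bool (linked D \<and> deg D = r)) /
    (E (\<lambda>D. of_bool (linked D \<and> deg D = r)) + E (\<lambda>D. of_bool (\<not> linked D \<and> deg D = r)))"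
  using E_split[of "\<lambda>D. deg D = r"]
  unfolding clustering_function_def cond_prob_def adjacent_eq_linked common_neighbours_eq_deg E_of_bool
  by simp

lemma clustering_coefficient_eq:
  "clustering_coefficient n m P =
    E (\<lambda>D. of_bool (common D 3 \<and> linked D)) /
    (E (\<lambda>D. of_bool (common D 3 \<and> linked D)) + E (\<lambda>D. of_bool (common D 3 \<and> \<not> linked D)))"
  using E_split[of "\<lambda>D. common D 3"]
  unfolding clustering_coefficient_def cond_prob_def adjacent_eq_linked adjacent_eq_common E_of_bool
  by (simp add: conj_commute)

lemma deg_eq_0_prob:
  "E (\<lambda>D. of_bool (linked D \<and> deg D = 0)) + E (\<lambda>D. of_bool (\<not> linked D \<and> deg D = 0)) =
    (1 :: real) - E (\<lambda>D. of_bool (deg D \<noteq> 0))"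
proof -
  have "E (\<lambda>D. of_bool (deg D = 0)) + E (\<lambda>D. of_bool (deg D \<noteq> 0)) = E (\<lambda>D. 1 :: real)"
  proof -
    have "E (\<lambda>D. of_bool (deg D = 0)) + E (\<lambda>D. of_bool (deg D \<noteq> 0)) = E (\<lambda>D. of_bool (deg D = 0) + of_bool (deg D \<noteq> 0) :: real)"
      by (rule Bochner_Integration.integral_add[symmetric]) simp_all
    also have "\<dots> = E (\<lambda>D. 1)" by (rule E_cong) auto
    finally show ?thesis .
  qed
  then show ?thesis using E_split[of "\<lambda>D. deg D = 0"] by simp
qed

text \<open>Rescaling by m or m^2 brings the compared quantities to order 1. Each error is then a
  polynomial in \<open>a\<close>, \<open>c\<close>, \<open>q\<close> divided by m, so it vanishes
  once these three stay bounded and m grows. The bound without 1/m only keeps the rescaled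
  non-adjacent part of \<alpha> bounded.\<close>

lemma scaled_bounds:
  fixes r :: nat
  defines "a \<equiv> m * p1" and "c \<equiv> m\<^sup>2 * p2" and "q \<equiv> real n / m"
  shows "\<bar>m * E (\<lambda>D. of_bool (linked D)) - a\<^sup>2\<bar> \<le> c\<^sup>2 / m"
    and "\<bar>m * E (\<lambda>D. of_bool (linked D \<and> deg D = r)) - a\<^sup>2 * (real ((n - 2) choose r) * p1 ^ r * (1 - p1) ^ (n - 2 - r))\<bar>
      \<le> (c\<^sup>2 + q * c * (2 * a * c + c\<^sup>2)) / m"
    and "E (\<lambda>D. of_bool (deg D \<noteq> 0)) \<le> q * (a ^ 3 + a\<^sup>2 * c) / m"
    and "\<bar>m\<^sup>2 * E (\<lambda>D. of_bool (common D 3 \<and> linked D)) - a ^ 3\<bar> \<le> c ^ 3 / m"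
    and "m\<^sup>2 * E (\<lambda>D. of_bool (common D 3 \<and> \<not> linked D)) \<le> a ^ 3 + a\<^sup>2 * c"
    and "\<bar>m * E (\<lambda>D. of_bool (\<not> linked D \<and> deg D = 1)) - (real n - 2) / m * (m\<^sup>2 * E (\<lambda>D. of_bool (common D 3 \<and> \<not> linked D)))\<bar>
      \<le> (q * (a + c) * c)\<^sup>2 / m"
    and "r \<ge> 2 \<Longrightarrow> m * E (\<lambda>D. of_bool (\<not> linked D \<and> deg D = r)) \<le> (q * (a + c) * c)\<^sup>2 / m"
proof -
  define x where "x = real m"
  have x: "x > 0" "x \<ge> 1" using m by (auto simp: x_def)
  have p: "p1 = a / x" "p2 = c / x\<^sup>2" "real n = q * x"
    using m by (auto simp: a_def c_def q_def x_def)
  have scale: "\<bar>s * A - s * B\<bar> \<le> s * C" if "\<bar>A - B\<bar> \<le> C" "s \<ge> 0" for s A B C :: real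
  proof -
    have "\<bar>s * A - s * B\<bar> = s * \<bar>A - B\<bar>" using that(2) by (simp add: right_diff_distrib[symmetric] abs_mult)
    then show ?thesis using mult_left_mono[OF that] by simp
  qed
  have "0 \<le> x\<^sup>2 * p2\<^sup>2" by simp
  then have "\<bar>E (\<lambda>D. of_bool (linked D)) - x * p1\<^sup>2\<bar> \<le> x\<^sup>2 * p2\<^sup>2"
    using prob_linked unfolding of_nat_power x_def[symmetric] by linarith
  then have "\<bar>x * E (\<lambda>D. of_bool (linked D)) - x * (x * p1\<^sup>2)\<bar> \<le> x * (x\<^sup>2 * p2\<^sup>2)"
    using x by (intro scale) auto
  moreover have "x * (x * p1\<^sup>2) = a\<^sup>2" "x * (x\<^sup>2 * p2\<^sup>2) = c\<^sup>2 / x"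
    using x by (simp_all add: p field_simps power2_eq_square)
  ultimately show "\<bar>m * E (\<lambda>D. of_bool (linked D)) - a\<^sup>2\<bar> \<le> c\<^sup>2 / m" by (simp only: x_def)
  let ?b = "real ((n - 2) choose r) * p1 ^ r * (1 - p1) ^ (n - 2 - r)"
  have "\<bar>x * E (\<lambda>D. of_bool (linked D \<and> deg D = r)) - x * (x * (p1\<^sup>2 * ?b))\<bar> \<le>
      x * (x\<^sup>2 * p2\<^sup>2 + n * x\<^sup>2 * p2 * (2 * p1 * p2 + x * p2\<^sup>2))"
    using prob_linked_deg[of r] x by (intro scale) (simp_all add: x_def)
  moreover have "x * (x * (p1\<^sup>2 * B)) = a\<^sup>2 * B" for B
    using x by (simp add: p field_simps power2_eq_square)
  moreover have "x * (x\<^sup>2 * p2\<^sup>2 + n * x\<^sup>2 * p2 * (2 * p1 * p2 + x * p2\<^sup>2)) = (c\<^sup>2 + q * c * (2 * a * c + c\<^sup>2)) / x"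
    using x by (simp add: p field_simps power2_eq_square)
  ultimately show "\<bar>m * E (\<lambda>D. of_bool (linked D \<and> deg D = r)) - a\<^sup>2 * ?b\<bar>
      \<le> (c\<^sup>2 + q * c * (2 * a * c + c\<^sup>2)) / m" by (simp only: x_def)
  have "E (\<lambda>D. of_bool (deg D \<noteq> 0)) \<le> n * (x * p1 ^ 3 + x\<^sup>2 * p1\<^sup>2 * p2)"
    using prob_deg_pos_le by (simp add: x_def)
  also have "\<dots> = q * (a ^ 3 + a\<^sup>2 * c) / x"
    using x by (simp add: p field_simps power2_eq_square power3_eq_cube)
  finally show "E (\<lambda>D. of_bool (deg D \<noteq> 0)) \<le> q * (a ^ 3 + a\<^sup>2 * c) / m" by (simp add: x_def)
  \<comment> \<open>The lower bound in \<open>prob_triangle\<close> has the error m^2 p2^3;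
    absorbing it into m^3 p2^3 gives one two-sided estimate.\<close>
  have le: "x\<^sup>2 * p2 ^ 3 \<le> x ^ 3 * p2 ^ 3"
    using x p_nonneg by (intro mult_right_mono power_increasing) auto
  have "\<bar>E (\<lambda>D. of_bool (common D 3 \<and> linked D)) - x * p1 ^ 3\<bar> \<le> x ^ 3 * p2 ^ 3"
    using prob_triangle le unfolding of_nat_power x_def[symmetric] by linarith
  then have "\<bar>x\<^sup>2 * E (\<lambda>D. of_bool (common D 3 \<and> linked D)) - x\<^sup>2 * (x * p1 ^ 3)\<bar> \<le> x\<^sup>2 * (x ^ 3 * p2 ^ 3)"
    by (intro scale) auto
  moreover have "x\<^sup>2 * (x * p1 ^ 3) = a ^ 3" "x\<^sup>2 * (x ^ 3 * p2 ^ 3) = c ^ 3 / x"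
    using x by (simp_all add: p field_simps power2_eq_square power3_eq_cube)
  ultimately show "\<bar>m\<^sup>2 * E (\<lambda>D. of_bool (common D 3 \<and> linked D)) - a ^ 3\<bar> \<le> c ^ 3 / m"
    by (simp only: x_def of_nat_power)
  have "E (\<lambda>D. of_bool (common D 3 \<and> \<not> linked D)) \<le> (E (\<lambda>D. of_bool (common D 3)) :: real)"
    by (rule E_mono) auto
  also have "\<dots> \<le> x * p1 ^ 3 + x\<^sup>2 * p1\<^sup>2 * p2"
    using prob_common_le[of 3] n by (simp add: x_def)
  finally have "x\<^sup>2 * E (\<lambda>D. of_bool (common D 3 \<and> \<not> linked D)) \<le> x\<^sup>2 * (x * p1 ^ 3 + x\<^sup>2 * p1\<^sup>2 * p2)"
    by (intro mult_left_mono) auto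
  also have "\<dots> = a ^ 3 + a\<^sup>2 * c"
    using x by (simp add: p field_simps power2_eq_square power3_eq_cube)
  finally show "m\<^sup>2 * E (\<lambda>D. of_bool (common D 3 \<and> \<not> linked D)) \<le> a ^ 3 + a\<^sup>2 * c"
    by (simp add: x_def)
  have err: "x * ((real n)\<^sup>2 * (x * p1 + x\<^sup>2 * p2)\<^sup>2 * p2\<^sup>2) = (q * (a + c) * c)\<^sup>2 / x"
    using x by (simp add: p field_simps power2_eq_square)
  let ?U = "E (\<lambda>D. of_bool (\<not> linked D \<and> deg D = 1))" and ?u = "E (\<lambda>D. of_bool (common D 3 \<and> \<not> linked D))"
  have "0 \<le> (real n)\<^sup>2 * (x * p1 + x\<^sup>2 * p2)\<^sup>2 * p2\<^sup>2" by simp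
  then have "\<bar>?U - (real n - 2) * ?u\<bar> \<le> (real n)\<^sup>2 * (x * p1 + x\<^sup>2 * p2)\<^sup>2 * p2\<^sup>2"
    using prob_not_linked_deg_1 unfolding of_nat_power x_def[symmetric] by linarith
  then have "\<bar>x * ?U - x * ((real n - 2) * ?u)\<bar> \<le> x * ((real n)\<^sup>2 * (x * p1 + x\<^sup>2 * p2)\<^sup>2 * p2\<^sup>2)"
    using x by (intro scale) auto
  moreover have "x * ((real n - 2) * ?u) = (real n - 2) / x * (x\<^sup>2 * ?u)"
    using x by (simp add: power2_eq_square)
  ultimately show "\<bar>m * ?U - (real n - 2) / m * (m\<^sup>2 * ?u)\<bar> \<le> (q * (a + c) * c)\<^sup>2 / m"
    unfolding err by (simp only: x_def of_nat_power)
  assume "r \<ge> 2"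
  then have "x * E (\<lambda>D. of_bool (\<not> linked D \<and> deg D = r)) \<le> x * ((real n)\<^sup>2 * (x * p1 + x\<^sup>2 * p2)\<^sup>2 * p2\<^sup>2)"
    using prob_not_linked_deg_ge_2[of r] x by (intro mult_left_mono) (simp_all add: x_def)
  then show "m * E (\<lambda>D. of_bool (\<not> linked D \<and> deg D = r)) \<le> (q * (a + c) * c)\<^sup>2 / m"
    unfolding err by (simp only: x_def)
qed

end

section \<open>Poisson limits and weak convergence of means\<close>

text \<open>The success probability is not c / N but only satisfies N p \<rightarrow> c, so the
  power of 1 - p is handled through its logarithm.\<close>

lemma tendsto_binomial_poisson:
  fixes p :: "nat \<Rightarrow> real" and N :: "nat \<Rightarrow> nat"
  assumes Np: "(\<lambda>n. real (N n) * p n) \<longlonglongrightarrow> c" and p0: "p \<longlonglongrightarrow> 0" and pos: "eventually (\<lambda>n. p n \<ge> 0) sequentially"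
    and N: "filterlim N at_top sequentially"
  shows "(\<lambda>n. real (N n choose r) * p n ^ r * (1 - p n) ^ (N n - r)) \<longlonglongrightarrow> c ^ r / fact r * exp (- c)"
proof -
  have 1: "(\<lambda>n. real (N n choose r) * p n ^ r) \<longlonglongrightarrow> c ^ r / fact r"
  proof -
    \<comment> \<open>The r factors p are distributed over the falling factorial, so that each
      factor tends to c.\<close>
    have "real (N n choose r) * p n ^ r = (\<Prod>i=0..<r. real (N n) * p n - real i * p n) / fact r" for n
    proof -
      have "(\<Prod>i=0..<r. real (N n) * p n - real i * p n) = (\<Prod>i=0..<r. (real (N n) - real i) * p n)"
        by (simp add: left_diff_distrib)
      also have "\<dots> = (\<Prod>i=0..<r. real (N n) - real i) * p n ^ r"
        by (simp add: prod.distrib)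
      finally show ?thesis by (simp add: binomial_gbinomial gbinomial_prod_rev)
    qed
    moreover have "(\<lambda>n. (\<Prod>i=0..<r. real (N n) * p n - real i * p n) / fact r) \<longlonglongrightarrow> (\<Prod>i=0..<r. c - real i * 0) / fact r"
      by (intro tendsto_intros Np p0) auto
    ultimately show ?thesis by simp
  qed
  \<comment> \<open>p < 1/2 secures ln (1 - p) \<ge> - p - 2 p^2, the lower half of the sandwich
    below; N \<ge> r keeps the subtraction of naturals exact.\<close>
  have ev: "eventually (\<lambda>n. 0 \<le> p n \<and> p n < 1 / 2 \<and> N n \<ge> r) sequentially"
    using pos order_tendstoD(2)[OF p0, of "1/2"] N[unfolded filterlim_at_top, rule_format, of r]
    by (simp add: eventually_conj_iff)
  have Nr: "(\<lambda>n. real (N n - r) * p n) \<longlonglongrightarrow> c"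
  proof -
    have "(\<lambda>n. real (N n) * p n - real r * p n) \<longlonglongrightarrow> c - real r * 0"
      by (intro tendsto_intros Np p0)
    moreover have "eventually (\<lambda>n. real (N n) * p n - real r * p n = real (N n - r) * p n) sequentially"
      using ev by eventually_elim (simp add: of_nat_diff algebra_simps)
    ultimately show ?thesis using tendsto_cong by fastforce
  qed
  have ln: "(\<lambda>n. real (N n - r) * ln (1 - p n)) \<longlonglongrightarrow> - c"
  proof (rule tendsto_sandwich)
    show "eventually (\<lambda>n. - (real (N n - r) * p n) - 2 * (real (N n - r) * p n) * p n \<le> real (N n - r) * ln (1 - p n)) sequentially"
      using ev
    proof eventually_elim
      case (elim n)
      have "real (N n - r) * (- p n - 2 * (p n)\<^sup>2) \<le> real (N n - r) * ln (1 - p n)"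
        using elim by (intro mult_left_mono ln_one_minus_pos_lower_bound) auto
      then show ?case by (simp add: algebra_simps power2_eq_square)
    qed
    show "eventually (\<lambda>n. real (N n - r) * ln (1 - p n) \<le> - (real (N n - r) * p n)) sequentially"
      using ev
    proof eventually_elim
      case (elim n)
      have "real (N n - r) * ln (1 - p n) \<le> real (N n - r) * (- p n)"
        using elim ln_le_minus_one[of "1 - p n"] by (intro mult_left_mono) auto
      then show ?case by simp
    qed
    have "(\<lambda>n. - (real (N n - r) * p n) - 2 * (real (N n - r) * p n) * p n) \<longlonglongrightarrow> - c - 2 * c * 0"
      by (intro tendsto_intros Nr p0)
    then show "(\<lambda>n. - (real (N n - r) * p n) - 2 * (real (N n - r) * p n) * p n) \<longlonglongrightarrow> - c" by simp
    show "(\<lambda>n. - (real (N n - r) * p n)) \<longlonglongrightarrow> - c"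
      by (intro tendsto_intros Nr)
  qed
  have "(\<lambda>n. exp (real (N n - r) * ln (1 - p n))) \<longlonglongrightarrow> exp (- c)"
    by (intro tendsto_intros ln)
  moreover have "eventually (\<lambda>n. exp (real (N n - r) * ln (1 - p n)) = (1 - p n) ^ (N n - r)) sequentially"
    using ev by eventually_elim (simp add: exp_of_nat_mult del: of_nat_diff)
  ultimately have 2: "(\<lambda>n. (1 - p n) ^ (N n - r)) \<longlonglongrightarrow> exp (- c)"
    using tendsto_cong by fastforce
  show ?thesis by (rule tendsto_mult[OF 1 2])
qed

section \<open>Nonnegativity and means of weak limits\<close>

lemma weak_conv_nonneg:
  fixes G :: "nat \<Rightarrow> 'a pmf" and X :: "nat \<Rightarrow> 'a \<Rightarrow> real"
  assumes "prob_space N" and Z[measurable]: "Z \<in> borel_measurable N"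
    and wc: "weak_conv_m (\<lambda>n. distr (G n) borel (X n)) (distr N borel Z)"
    and X: "\<And>n x. X n x \<ge> 0"
  shows "AE x in N. Z x \<ge> 0"
proof -
  interpret N: prob_space N by fact
  interpret rd: real_distribution "distr (G n) borel (X n)" for n
    by (intro real_distribution.intro real_distribution_axioms.intro prob_space.prob_space_distr prob_space_measure_pmf) auto
  interpret rdN: real_distribution "distr N borel Z"
    by (intro real_distribution.intro real_distribution_axioms.intro N.prob_space_distr) auto
  \<comment> \<open>A bounded continuous test function that vanishes exactly on the nonnegative
    reals. Its mean is 0 along the sequence, hence also in the limit.\<close>
  define h :: "real \<Rightarrow> real" where "h x = max 0 (min (- x) 1)" for x
  have [measurable]: "h \<in> borel_measurable borel" unfolding h_def by measurable
  have h0: "h (X n x) = 0" for n x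
    using X[of n x] by (simp add: h_def min_def max_def)
  have "(\<lambda>n. integral\<^sup>L (distr (G n) borel (X n)) h) \<longlonglongrightarrow> integral\<^sup>L (distr N borel Z) h"
    by (rule weak_conv_imp_integral_bdd_continuous_conv[OF rd.real_distribution_axioms rdN.real_distribution_axioms wc, where B=1])
      (auto simp: h_def[abs_def] intro!: continuous_intros)
  then have "(\<lambda>n. 0) \<longlonglongrightarrow> (\<integral>x. h (Z x) \<partial>N)"
    using h0 by (simp add: integral_distr)
  then have "(\<integral>x. h (Z x) \<partial>N) = 0" by (simp add: LIMSEQ_const_iff)
  moreover have "integrable N (\<lambda>x. h (Z x))"
    by (rule N.integrable_const_bound[where B=1]) (auto simp: h_def)
  ultimately have "AE x in N. h (Z x) = 0"
    by (subst (asm) integral_nonneg_eq_0_iff_AE) (auto simp: h_def)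
  then show ?thesis by eventually_elim (auto simp: h_def split: if_splits)
qed

definition truncate :: "real \<Rightarrow> real \<Rightarrow> real" where
  "truncate K x = max 0 (min x K)"

lemma truncate_borel [measurable]: "truncate K \<in> borel_measurable borel"
  unfolding truncate_def by measurable

text \<open>Clipping changes y \<ge> 0 only if y > K, and then y \<le> y^2 / K.\<close>

lemma expectation_truncate:
  assumes K: "K > 0" and "prob_space Q" and Y: "AE x in Q. Y x \<ge> 0" "integrable Q Y" "integrable Q (\<lambda>x. (Y x)\<^sup>2)"
  shows "\<bar>(\<integral>x. Y x \<partial>Q) - (\<integral>x. truncate K (Y x) \<partial>Q)\<bar> \<le> (\<integral>x. (Y x)\<^sup>2 \<partial>Q) / K"
proof -
  interpret Q: prob_space Q by fact
  have [measurable]: "Y \<in> borel_measurable Q" using Y by auto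
  have trunc: "\<bar>x - truncate K x\<bar> \<le> x\<^sup>2 / K" if "x \<ge> 0" for x
  proof (cases "x \<le> K")
    case False
    then have "K * x \<le> x * x" using that by (intro mult_right_mono) auto
    then have "x \<le> x\<^sup>2 / K" using K by (simp add: field_simps power2_eq_square)
    then show ?thesis using False K by (simp add: truncate_def)
  qed (use that K in \<open>simp add: truncate_def\<close>)
  have iT: "integrable Q (\<lambda>x. truncate K (Y x))"
    by (rule Q.integrable_const_bound[where B=K]) (use K in \<open>auto simp: truncate_def\<close>)
  have "\<bar>(\<integral>x. Y x \<partial>Q) - (\<integral>x. truncate K (Y x) \<partial>Q)\<bar> = \<bar>\<integral>x. Y x - truncate K (Y x) \<partial>Q\<bar>"
    using Y iT by simp
  also have "\<dots> \<le> (\<integral>x. \<bar>Y x - truncate K (Y x)\<bar> \<partial>Q)" by (rule integral_abs_bound)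
  also have "\<dots> \<le> (\<integral>x. (Y x)\<^sup>2 / K \<partial>Q)"
    using Y iT trunc by (intro integral_mono_AE) auto
  finally show ?thesis by simp
qed

text \<open>The identity is unbounded, so weak convergence alone does not give convergence of means.
  Bounded second moments make the truncation error uniform in n, and \<open>truncate K\<close> is
  bounded and continuous.\<close>

lemma weak_conv_mean:
  fixes G :: "nat \<Rightarrow> 'a pmf" and X :: "nat \<Rightarrow> 'a \<Rightarrow> real"
  assumes "prob_space N" and Z[measurable]: "Z \<in> borel_measurable N"
    and wc: "weak_conv_m (\<lambda>n. distr (G n) borel (X n)) (distr N borel Z)"
    and X: "\<And>n x. X n x \<ge> 0"
    and intX2: "\<And>n. integrable (G n) (\<lambda>x. (X n x)\<^sup>2)"
    and intZ2: "integrable N (\<lambda>x. (Z x)\<^sup>2)"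
    and bdd: "Bseq (\<lambda>n. measure_pmf.expectation (G n) (\<lambda>x. (X n x)\<^sup>2))"
  shows "(\<lambda>n. measure_pmf.expectation (G n) (X n)) \<longlonglongrightarrow> (\<integral>x. Z x \<partial>N)"
proof -
  interpret N: prob_space N by fact
  interpret rd: real_distribution "distr (G n) borel (X n)" for n
    by (intro real_distribution.intro real_distribution_axioms.intro prob_space.prob_space_distr prob_space_measure_pmf) auto
  interpret rdN: real_distribution "distr N borel Z"
    by (intro real_distribution.intro real_distribution_axioms.intro N.prob_space_distr) auto
  have Zpos: "AE x in N. Z x \<ge> 0" by (rule weak_conv_nonneg[OF assms(1-4)])
  have intX: "integrable (G n) (X n)" for n
    using measure_pmf.square_integrable_imp_integrable[OF _ intX2] by simp
  have intZ: "integrable N Z"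
    using N.square_integrable_imp_integrable[OF Z intZ2] .
  obtain B where B: "\<And>n. measure_pmf.expectation (G n) (\<lambda>x. (X n x)\<^sup>2) \<le> B" "B > 0"
    using bdd unfolding Bseq_def by (metis abs_le_D1 real_norm_def)
  show ?thesis
  proof (rule LIMSEQ_I)
    fix e :: real assume e: "e > 0"
    \<comment> \<open>The truncation errors of \<open>X n\<close> and \<open>Z\<close> add up to at
      most C / K, and K = 2 C / e makes this e / 2; the other half is left for the truncated
      means.\<close>
    define C where "C = B + (\<integral>x. (Z x)\<^sup>2 \<partial>N)"
    have C: "C > 0" using B by (simp add: C_def add_pos_nonneg)
    define K where "K = 2 * C / e"
    have K: "K > 0" using C e by (simp add: K_def)
    have "(\<lambda>n. integral\<^sup>L (distr (G n) borel (X n)) (truncate K)) \<longlonglongrightarrow> integral\<^sup>L (distr N borel Z) (truncate K)"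
      by (rule weak_conv_imp_integral_bdd_continuous_conv[OF rd.real_distribution_axioms rdN.real_distribution_axioms wc, where B=K])
        (use K in \<open>auto simp: truncate_def[abs_def] intro!: continuous_intros\<close>)
    then have "(\<lambda>n. measure_pmf.expectation (G n) (\<lambda>x. truncate K (X n x))) \<longlonglongrightarrow> (\<integral>x. truncate K (Z x) \<partial>N)"
      by (simp add: integral_distr)
    from LIMSEQ_D[OF this, of "e / 2"] e
    obtain n0 where n0: "\<And>n. n \<ge> n0 \<Longrightarrow> \<bar>measure_pmf.expectation (G n) (\<lambda>x. truncate K (X n x)) - (\<integral>x. truncate K (Z x) \<partial>N)\<bar> < e / 2"
      by auto
    show "\<exists>n0. \<forall>n\<ge>n0. norm (measure_pmf.expectation (G n) (X n) - (\<integral>x. Z x \<partial>N)) < e"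
    proof (intro exI allI impI)
      fix n assume "n \<ge> n0"
      have 1: "\<bar>measure_pmf.expectation (G n) (X n) - measure_pmf.expectation (G n) (\<lambda>x. truncate K (X n x))\<bar> \<le> B / K"
      proof (rule order_trans)
        show "\<bar>measure_pmf.expectation (G n) (X n) - measure_pmf.expectation (G n) (\<lambda>x. truncate K (X n x))\<bar> \<le>
            measure_pmf.expectation (G n) (\<lambda>x. (X n x)\<^sup>2) / K"
          by (rule expectation_truncate[OF K prob_space_measure_pmf _ intX intX2]) (simp add: X)
        show "measure_pmf.expectation (G n) (\<lambda>x. (X n x)\<^sup>2) / K \<le> B / K"
          using B(1)[of n] K by (intro divide_right_mono) auto
      qed
      have 2: "\<bar>(\<integral>x. Z x \<partial>N) - (\<integral>x. truncate K (Z x) \<partial>N)\<bar> \<le> (\<integral>x. (Z x)\<^sup>2 \<partial>N) / K"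
        by (rule expectation_truncate[OF K assms(1) Zpos intZ intZ2])
      have "B / K + (\<integral>x. (Z x)\<^sup>2 \<partial>N) / K = e / 2"
      proof -
        have "B / K + (\<integral>x. (Z x)\<^sup>2 \<partial>N) / K = C / K" by (simp add: C_def add_divide_distrib)
        also have "\<dots> = e / 2" using C e by (simp add: K_def)
        finally show ?thesis .
      qed
      with 1 2 n0[OF \<open>n \<ge> n0\<close>] show "norm (measure_pmf.expectation (G n) (X n) - (\<integral>x. Z x \<partial>N)) < e"
        unfolding real_norm_def by linarith
    qed
  qed
qed

section \<open>The mean of the mixed Poisson distribution\<close>

lemma poisson_mean_sums: "(\<lambda>k. real k * (exp (- x) * x ^ k / fact k)) sums (x :: real)"
proof -
  have "(\<lambda>k. exp (- x) * x * (x ^ k /\<^sub>R fact k)) sums (exp (- x) * x * exp x)"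
    by (intro sums_mult exp_converges)
  also have "exp (- x) * x * exp x = x" by (simp add: exp_minus)
  also have "(\<lambda>k. exp (- x) * x * (x ^ k /\<^sub>R fact k)) = (\<lambda>k. real (Suc k) * (exp (- x) * x ^ Suc k / fact (Suc k)))"
    by (rule ext) (simp add: field_simps del: of_nat_Suc)
  finally show ?thesis by (subst (asm) sums_Suc_iff) simp
qed

text \<open>Given Z, the law is Poisson with mean z Z, where z = E Z, so its mean is z E Z. Sum and
  integral are exchanged in the extended nonnegative reals, where integrability of the degree need
  not be known beforehand.\<close>

lemma mixed_poisson_mean:
  assumes "prob_space N" and Z[measurable]: "Z \<in> borel_measurable N" and nonneg: "AE x in N. Z x \<ge> 0"
    and int: "integrable N Z"
  shows "mixed_poisson_moment N Z 1 = (\<integral>x. Z x \<partial>N)\<^sup>2"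
proof -
  interpret prob_space N by fact
  define z where "z = (\<integral>x. Z x \<partial>N)"
  have z: "z \<ge> 0" unfolding z_def using nonneg by (rule integral_nonneg_AE)
  define f where "f = (\<lambda>k x. exp (- z * Z x) * (z * Z x) ^ k / fact k)"
  have [measurable]: "f k \<in> borel_measurable N" for k unfolding f_def by measurable
  have f: "AE x in N. 0 \<le> f k x \<and> f k x \<le> 1" for k
    using nonneg
  proof eventually_elim
    case (elim x)
    \<comment> \<open>For a positive rate \<open>f k x\<close> is a weight of
      \<open>poisson_pmf\<close>; at rate 0 it is 1 for k = 0 and 0 otherwise.\<close>
    then consider "z * Z x = 0" | "z * Z x > 0" using z by fastforce
    then show ?case
    proof cases
      case 1
      have "f k x = exp (- (z * Z x)) * (z * Z x) ^ k / fact k" by (simp add: f_def)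
      then have "f k x = 0 ^ k / fact k" unfolding 1 by simp
      then show ?thesis by (cases k) auto
    next
      case 2
      then have "f k x = pmf (poisson_pmf (z * Z x)) k" by (simp add: f_def)
      then show ?thesis by (simp add: pmf_le_1)
    qed
  qed
  have int_f: "integrable N (f k)" for k
    by (rule integrable_const_bound[where B=1]) (use f[of k] in auto)
  have pmf_f: "ennreal (pmf (mixed_poisson N Z) k) = (\<integral>\<^sup>+x. f k x \<partial>N)" for k
    unfolding pmf_mixed_poisson[OF assms(1-3)] z_def[symmetric] f_def[symmetric]
    using f[of k] int_f[of k] by (subst nn_integral_eq_integral) (auto simp: f_def)
  have "(\<integral>\<^sup>+k. ennreal (real k) \<partial>mixed_poisson N Z) = (\<Sum>k. ennreal (pmf (mixed_poisson N Z) k) * ennreal (real k))"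
    by (simp add: nn_integral_measure_pmf nn_integral_count_space_nat)
  also have "\<dots> = (\<Sum>k. \<integral>\<^sup>+x. ennreal (real k) * ennreal (f k x) \<partial>N)"
    by (simp add: pmf_f nn_integral_cmult mult.commute)
  also have "\<dots> = (\<integral>\<^sup>+x. (\<Sum>k. ennreal (real k) * ennreal (f k x)) \<partial>N)"
    by (rule nn_integral_suminf[symmetric]) measurable
  also have "\<dots> = (\<integral>\<^sup>+x. ennreal (z * Z x) \<partial>N)"
  proof (rule nn_integral_cong_AE)
    have "AE x in N. \<forall>k. 0 \<le> f k x" unfolding AE_all_countable using f by auto
    then show "AE x in N. (\<Sum>k. ennreal (real k) * ennreal (f k x)) = ennreal (z * Z x)"
    proof eventually_elim
      case (elim x)
      have s: "(\<lambda>k. real k * f k x) sums (z * Z x)"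
        using poisson_mean_sums[of "z * Z x"] by (simp add: f_def)
      have "(\<Sum>k. ennreal (real k * f k x)) = ennreal (\<Sum>k. real k * f k x)"
        using elim by (intro suminf_ennreal2 sums_summable[OF s]) auto
      then show ?case
        using sums_unique[OF s] elim by (simp add: ennreal_mult)
    qed
  qed
  also have "\<dots> = ennreal (\<integral>x. z * Z x \<partial>N)"
    using nonneg z int by (intro nn_integral_eq_integral) auto
  also have "(\<integral>x. z * Z x \<partial>N) = z\<^sup>2" by (simp add: z_def power2_eq_square)
  finally have "(\<integral>\<^sup>+k. ennreal (real k) \<partial>mixed_poisson N Z) = ennreal (z\<^sup>2)" .
  then have "measure_pmf.expectation (mixed_poisson N Z) real = z\<^sup>2"
    by (subst integral_eq_nn_integral) auto
  then show ?thesis by (simp add: mixed_poisson_moment_def z_def)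
qed

section \<open>Asymptotics of the clustering function\<close>

text \<open>For r = 1, x and y are the rescaled adjacent and non-adjacent parts of the event d = 1,
  and T, W those of the event that vertex 3 is a common neighbour. As W is only bounded, neither
  side need converge; their quotient is 1 plus a null sequence over a denominator bounded away from
  0.\<close>

lemma ratio_asymp_equiv:
  fixes x y T W :: "nat \<Rightarrow> real"
  assumes x: "x \<longlonglongrightarrow> A * k * exp (- \<Lambda>)" and T: "T \<longlonglongrightarrow> A" and y: "(\<lambda>n. y n - k * W n) \<longlonglongrightarrow> 0"
    and W: "eventually (\<lambda>n. 0 \<le> W n \<and> W n \<le> C) sequentially" and y0: "\<And>n. y n \<ge> 0"
    and A: "A > 0" and k: "k > 0"
  shows "(\<lambda>n. x n / (x n + y n)) \<sim>[sequentially] (\<lambda>n. T n / (T n + W n * exp \<Lambda>))"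
proof (rule asymp_equivI')
  define B where "B = A * k * exp (- \<Lambda>)"
  have B: "B > 0" using A k by (simp add: B_def)
  \<comment> \<open>\<open>d\<close> equals x (T + W exp \<Lambda>) - (x + y) T, which is x W exp
    \<Lambda> - y T, arranged so that every summand is a null factor times a bounded one.\<close>
  define d where "d n = (x n * exp \<Lambda> - A * k) * W n - (y n - k * W n) * T n - (T n - A) * (k * W n)" for n
  have "(\<lambda>n. (x n * exp \<Lambda> - A * k) * W n) \<longlonglongrightarrow> 0"
  proof (rule lim_null_mult_right_bounded)
    have "(\<lambda>n. x n * exp \<Lambda> - A * k) \<longlonglongrightarrow> A * k * exp (- \<Lambda>) * exp \<Lambda> - A * k"
      by (intro tendsto_intros x)
    then show "(\<lambda>n. x n * exp \<Lambda> - A * k) \<longlonglongrightarrow> 0"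
      by (simp add: mult.assoc mult_exp_exp)
    show "eventually (\<lambda>n. norm (W n) \<le> C) sequentially" using W by eventually_elim auto
  qed
  moreover have "(\<lambda>n. (y n - k * W n) * T n) \<longlonglongrightarrow> 0"
    using tendsto_mult[OF y T] by simp
  moreover have "(\<lambda>n. (T n - A) * (k * W n)) \<longlonglongrightarrow> 0"
  proof (rule lim_null_mult_right_bounded)
    show "(\<lambda>n. T n - A) \<longlonglongrightarrow> 0" using T by (simp add: LIM_zero_iff)
    show "eventually (\<lambda>n. norm (k * W n) \<le> k * C) sequentially"
      using W by eventually_elim (use k in auto)
  qed
  ultimately have "d \<longlonglongrightarrow> 0 - 0 - 0"
    unfolding d_def[abs_def] by (intro tendsto_diff)
  then have d0: "d \<longlonglongrightarrow> 0" by simp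
  have ev: "eventually (\<lambda>n. x n > B / 2 \<and> T n > A / 2 \<and> W n \<ge> 0) sequentially"
  proof -
    have "eventually (\<lambda>n. x n > B / 2) sequentially"
      using x B by (intro order_tendstoD(1)) (auto simp: B_def)
    moreover have "eventually (\<lambda>n. T n > A / 2) sequentially"
      using T A by (intro order_tendstoD(1)) auto
    ultimately show ?thesis using W by eventually_elim auto
  qed
  have "(\<lambda>n. d n * (1 / ((x n + y n) * T n))) \<longlonglongrightarrow> 0"
  proof (rule lim_null_mult_right_bounded[OF d0])
    show "eventually (\<lambda>n. norm (1 / ((x n + y n) * T n)) \<le> 1 / (B / 2 * (A / 2))) sequentially"
      using ev
    proof eventually_elim
      case (elim n)
      define X where "X = (x n + y n) * T n"
      define Y where "Y = B / 2 * (A / 2)"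
      have "Y \<le> X" unfolding X_def Y_def
        using elim y0[of n] A B by (intro mult_mono) auto
      moreover have "Y > 0" using A B by (simp add: Y_def)
      ultimately have "1 / X \<le> 1 / Y" "1 / X > 0"
        by (auto intro!: divide_left_mono mult_pos_pos)
      then show ?case unfolding X_def Y_def by simp
    qed
  qed
  then have "(\<lambda>n. 1 + d n * (1 / ((x n + y n) * T n))) \<longlonglongrightarrow> 1 + 0" by (intro tendsto_intros)
  moreover have "eventually (\<lambda>n. 1 + d n * (1 / ((x n + y n) * T n)) =
      x n / (x n + y n) / (T n / (T n + W n * exp \<Lambda>))) sequentially"
    using ev
  proof eventually_elim
    case (elim n)
    have pos: "x n + y n > 0" "T n > 0" using elim y0[of n] A B by auto
    have "T n + W n * exp \<Lambda> > 0" using pos elim by (intro add_pos_nonneg) auto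
    have "d n = x n * (T n + W n * exp \<Lambda>) - (x n + y n) * T n"
      by (simp add: d_def algebra_simps)
    moreover have "1 + (x n * V - s * T n) * (1 / (s * T n)) = x n / s / (T n / V)" if "s \<noteq> 0" "V \<noteq> 0" for s V
      using that pos by (simp add: field_simps)
    ultimately show ?case using pos \<open>T n + W n * exp \<Lambda> > 0\<close> by simp
  qed
  ultimately show "(\<lambda>n. x n / (x n + y n) / (T n / (T n + W n * exp \<Lambda>))) \<longlonglongrightarrow> 1"
    by (simp add: tendsto_cong)
qed

theorem theorem1:
  fixes m :: "nat \<Rightarrow> nat" and P :: "nat \<Rightarrow> nat pmf"
    and N :: "'z measure" and Z :: "'z \<Rightarrow> real"
    and \<beta> \<Lambda> :: real
  assumes "\<And>n. set_pmf (P n) \<subseteq> {0..m n}"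
    and "filterlim m at_top sequentially"
    and "prob_space N" and "Z \<in> borel_measurable N"
    and "weak_conv_m
           (\<lambda>n. distr (active_rig n (m n) (P n)) borel
                  (\<lambda>D. real (card (D 1)) * sqrt (real n / real (m n))))
           (distr N borel Z)"
    and "integrable N (\<lambda>x. (Z x)\<^sup>2)"
    and "(\<lambda>n. measure_pmf.expectation (active_rig n (m n) (P n))
                (\<lambda>D. (real (card (D 1)) * sqrt (real n / real (m n)))\<^sup>2))
           \<longlonglongrightarrow> (\<integral>x. (Z x)\<^sup>2 \<partial>N)"
    and "(\<integral>x. Z x \<partial>N) > 0"
    and "(\<lambda>n. real (m n) / real n) \<longlonglongrightarrow> \<beta>" and "\<beta> > 0"
    and "\<Lambda> = sqrt (mixed_poisson_moment N Z 1 / \<beta>)"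
  shows "((\<lambda>n. clustering_function n (m n) (P n) 0)
            \<sim>[sequentially] (\<lambda>n. edge_probability n (m n) (P n) * exp (- \<Lambda>))) \<and>
         ((\<lambda>n. clustering_function n (m n) (P n) 1)
            \<sim>[sequentially]
              (\<lambda>n. let \<alpha> = clustering_coefficient n (m n) (P n)
                   in \<alpha> / (\<alpha> + (1 - \<alpha>) * exp \<Lambda>))) \<and>
         (\<forall>r\<ge>2. (\<lambda>n. clustering_function n (m n) (P n) r) \<longlonglongrightarrow> 1)"
proof -
  interpret N: prob_space N by fact
  define z where "z = (\<integral>x. Z x \<partial>N)"
  \<comment> \<open>The factor sqrt \<beta> undoes the normalisation of X_1 by sqrt(n/m).\<close>
  define \<mu> where "\<mu> = sqrt \<beta> * z"
  have z: "z > 0" using assms(8) by (simp add: z_def)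
  have \<beta>: "\<beta> > 0" by fact
  have \<mu>: "\<mu> > 0" using z \<beta> by (simp add: \<mu>_def)
  have \<mu>3: "\<mu> ^ 3 > 0" using \<mu> by simp
  let ?G = "\<lambda>n. active_rig n (m n) (P n)"
  let ?E = "\<lambda>n f. measure_pmf.expectation (?G n) f :: real"
  let ?X = "\<lambda>n D. real (card (D 1)) * sqrt (real n / real (m n)) :: real"
  have int: "integrable (?G n) f" for n and f :: "(nat \<Rightarrow> nat set) \<Rightarrow> real"
    by (rule integrable_measure_pmf_finite[OF finite_set_active_rig[OF assms(1)]])
  have "AE x in N. Z x \<ge> 0"
    by (rule weak_conv_nonneg[OF assms(3-5)]) simp
  then have "mixed_poisson_moment N Z 1 = z\<^sup>2"
    unfolding z_def using N.square_integrable_imp_integrable[OF assms(4,6)]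
    by (intro mixed_poisson_mean assms)
  \<comment> \<open>In this form \<Lambda> is the limit of n p1 = (n / m) (m p1), the mean of the
    Poisson limit.\<close>
  then have \<Lambda>: "\<Lambda> = \<mu> / \<beta>"
  proof -
    assume "mixed_poisson_moment N Z 1 = z\<^sup>2"
    then have "\<Lambda> = z / sqrt \<beta>" using z assms(11) by (simp add: real_sqrt_divide)
    also have "\<dots> = z * (sqrt \<beta> / \<beta>)"
      using \<beta> by (subst sqrt_divide_self_eq) (simp_all add: divide_inverse)
    also have "\<dots> = \<mu> / \<beta>" by (simp add: \<mu>_def)
    finally show ?thesis .
  qed
  have mean: "(\<lambda>n. ?E n (?X n)) \<longlonglongrightarrow> z"
    unfolding z_def
    by (rule weak_conv_mean[OF assms(3-5) _ int assms(6)])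
      (simp, rule convergent_imp_Bseq[OF convergentI[OF assms(7)]])

  have m_top: "filterlim (\<lambda>n. real (m n)) at_top sequentially"
    using assms(2) by (rule filterlim_compose[OF filterlim_real_sequentially])
  \<comment> \<open>The locale assumptions hold only for large n, so its bounds are imported under
    \<open>eventually\<close>.\<close>
  have ok: "eventually (\<lambda>n. active_graph n (m n) (P n)) sequentially"
  proof -
    have "eventually (\<lambda>n. m n \<ge> 2) sequentially"
      using assms(2) by (simp add: filterlim_at_top)
    then show ?thesis
      using eventually_ge_at_top[of 3] by eventually_elim (simp add: active_graph_def assms(1))
  qed
  then have pos: "eventually (\<lambda>n. real n > 0 \<and> real (m n) > 0) sequentially"
    by eventually_elim (auto simp: active_graph_def)

  define q where "q n = real n / real (m n)" for n
  define p where "p n = active_graph.p1 (m n) (P n)" for n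
  define a where "a n = m n * p n" for n
  define c where "c n = (m n)\<^sup>2 * active_graph.p2 (m n) (P n)" for n
  have q: "q \<longlonglongrightarrow> 1 / \<beta>"
  proof -
    have "(\<lambda>n. inverse (real (m n) / real n)) \<longlonglongrightarrow> inverse \<beta>"
      using assms(9) \<beta> by (intro tendsto_inverse) auto
    then show ?thesis by (simp add: q_def[abs_def] inverse_eq_divide)
  qed
  have a: "a \<longlonglongrightarrow> \<mu>"
  proof -
    have "(\<lambda>n. sqrt (real (m n) / real n) * ?E n (?X n)) \<longlonglongrightarrow> sqrt \<beta> * z"
      by (intro tendsto_mult tendsto_real_sqrt assms(9) mean)
    moreover have "eventually (\<lambda>n. sqrt (real (m n) / real n) * ?E n (?X n) = a n) sequentially"
      using ok pos
    proof eventually_elim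
      case (elim n)
      then interpret active_graph n "m n" "P n" by simp
      have "sqrt (real (m n) / real n) * sqrt (real n / real (m n)) = 1"
        using elim by (simp add: real_sqrt_mult[symmetric])
      then have "sqrt (real (m n) / real n) * (?E n (\<lambda>D. real (card (D 1))) * sqrt (real n / real (m n))) = ?E n (\<lambda>D. real (card (D 1)))"
        by (simp add: mult_ac)
      then show ?case by (simp only: E_card a_def p_def integral_mult_left_zero)
    qed
    ultimately show ?thesis by (simp add: tendsto_cong \<mu>_def)
  qed
  have c: "c \<in> O(\<lambda>_. 1)"
  proof -
    \<comment> \<open>For large n this is E X_1^2, written so that its convergence follows from that
      of m/n and of the normalised second moment.\<close>
    define S where "S = (\<lambda>n. real (m n) / real n * ?E n (\<lambda>D. (?X n D)\<^sup>2))"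
    have "S \<longlonglongrightarrow> \<beta> * (\<integral>x. (Z x)\<^sup>2 \<partial>N)"
      unfolding S_def by (intro tendsto_mult assms)
    then have "(\<lambda>n. 2 * S n) \<in> O(\<lambda>_. 1)"
      by (intro bigoI_tendsto[where c="2 * (\<beta> * (\<integral>x. (Z x)\<^sup>2 \<partial>N))"]) (auto intro!: tendsto_intros)
    moreover have "c \<in> O(\<lambda>n. 2 * S n)"
    proof (rule landau_o.big_mono)
      show "eventually (\<lambda>n. norm (c n) \<le> norm (2 * S n)) sequentially"
        using ok pos
      proof eventually_elim
        case (elim n)
        then interpret active_graph n "m n" "P n" by simp
        have "S n = ?E n (\<lambda>D. (real (card (D 1)))\<^sup>2)"
          using elim by (simp add: S_def power_mult_distrib)
        then have "c n \<le> 2 * S n" using p2_le by (simp add: c_def)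
        moreover have "c n \<ge> 0" using p_nonneg by (simp add: c_def)
        ultimately show ?case by simp
      qed
    qed
    ultimately show ?thesis by (rule landau_o.big_trans[rotated])
  qed
  have aO: "a \<in> O(\<lambda>_. 1)" by (rule bigoI_tendsto[where c=\<mu>]) (use a in auto)
  have qO: "q \<in> O(\<lambda>_. 1)" by (rule bigoI_tendsto[where c="1/\<beta>"]) (use q in auto)
  have null: "(\<lambda>n. f n / m n) \<longlonglongrightarrow> 0" if "f \<in> O(\<lambda>_. 1)" for f :: "nat \<Rightarrow> real"
  proof -
    from that obtain B where "eventually (\<lambda>n. norm (f n) \<le> B) sequentially"
      by (elim landau_o.bigE) auto
    moreover have "(\<lambda>n. inverse (real (m n))) \<longlonglongrightarrow> 0"
      by (rule tendsto_inverse_0_at_top[OF m_top])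
    ultimately have "(\<lambda>n. f n * inverse (real (m n))) \<longlonglongrightarrow> 0"
      by (rule lim_null_mult_left_bounded)
    then show ?thesis by (simp add: divide_inverse)
  qed
  note bigO_intros = landau_o.big.mult_in_1 sum_in_bigo(1) c aO qO

  define L where "L r n = ?E n (\<lambda>D. of_bool (active_graph.linked D \<and> active_graph.deg n D = r))" for r n
  define U where "U r n = ?E n (\<lambda>D. of_bool (\<not> active_graph.linked D \<and> active_graph.deg n D = r))" for r n
  define t where "t n = ?E n (\<lambda>D. of_bool (active_graph.common D 3 \<and> active_graph.linked D))" for n
  define u where "u n = ?E n (\<lambda>D. of_bool (active_graph.common D 3 \<and> \<not> active_graph.linked D))" for n
  have nonneg: "L r n \<ge> 0" "U r n \<ge> 0" "t n \<ge> 0" "u n \<ge> 0" for r n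
    by (simp_all add: L_def U_def t_def u_def)

  have p0: "p \<longlonglongrightarrow> 0"
  proof -
    have "(\<lambda>n. a n / m n) \<longlonglongrightarrow> 0" by (rule null[OF aO])
    moreover have "eventually (\<lambda>n. a n / m n = p n) sequentially"
      using pos by eventually_elim (simp add: a_def)
    ultimately show ?thesis by (simp add: tendsto_cong)
  qed
  define b where "b r n = real ((n - 2) choose r) * p n ^ r * (1 - p n) ^ (n - 2 - r)" for r n
  have b: "b r \<longlonglongrightarrow> \<Lambda> ^ r / fact r * exp (- \<Lambda>)" for r
    unfolding b_def[abs_def]
  proof (rule tendsto_binomial_poisson)
    \<comment> \<open>n p = q a, and only n - 2 vertices are counted; the correction 2 p
      vanishes.\<close>
    have "(\<lambda>n. q n * a n - 2 * p n) \<longlonglongrightarrow> 1 / \<beta> * \<mu> - 2 * 0"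
      by (intro tendsto_intros q a p0)
    moreover have "eventually (\<lambda>n. q n * a n - 2 * p n = real (n - 2) * p n) sequentially"
      using ok pos by eventually_elim (simp add: q_def a_def active_graph_def of_nat_diff algebra_simps)
    ultimately show "(\<lambda>n. real (n - 2) * p n) \<longlonglongrightarrow> \<Lambda>"
      by (simp add: tendsto_cong \<Lambda>)
    show "eventually (\<lambda>n. p n \<ge> 0) sequentially"
      using ok by eventually_elim (simp add: p_def active_graph.p_nonneg)
    show "filterlim (\<lambda>n. n - 2) at_top sequentially" by (rule filterlim_minus_const_nat_at_top)
  qed (rule p0)

  have L: "(\<lambda>n. m n * L r n) \<longlonglongrightarrow> \<mu>\<^sup>2 * (\<Lambda> ^ r / fact r * exp (- \<Lambda>))" for r
  proof -
    have "(\<lambda>n. ((c n)\<^sup>2 + q n * c n * (2 * a n * c n + (c n)\<^sup>2)) / m n) \<longlonglongrightarrow> 0"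
      unfolding power2_eq_square by (intro null bigO_intros) auto
    then have "(\<lambda>n. m n * L r n - (a n)\<^sup>2 * b r n) \<longlonglongrightarrow> 0"
    proof (rule Lim_null_comparison[rotated])
      show "eventually (\<lambda>n. norm (m n * L r n - (a n)\<^sup>2 * b r n) \<le>
          ((c n)\<^sup>2 + q n * c n * (2 * a n * c n + (c n)\<^sup>2)) / m n) sequentially"
        using ok by eventually_elim
          (simp only: real_norm_def L_def b_def a_def c_def q_def p_def, rule active_graph.scaled_bounds)
    qed
    then show ?thesis by (rule Lim_transform[rotated]) (intro tendsto_intros a b)
  qed
  have edge: "(\<lambda>n. m n * edge_probability n (m n) (P n)) \<longlonglongrightarrow> \<mu>\<^sup>2"
  proof -
    have "(\<lambda>n. (c n)\<^sup>2 / m n) \<longlonglongrightarrow> 0"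
      unfolding power2_eq_square by (intro null bigO_intros)
    then have "(\<lambda>n. m n * edge_probability n (m n) (P n) - (a n)\<^sup>2) \<longlonglongrightarrow> 0"
    proof (rule Lim_null_comparison[rotated])
      show "eventually (\<lambda>n. norm (m n * edge_probability n (m n) (P n) - (a n)\<^sup>2) \<le> (c n)\<^sup>2 / m n) sequentially"
        using ok by eventually_elim
          (simp only: real_norm_def active_graph.edge_probability_eq a_def c_def p_def, rule active_graph.scaled_bounds)
    qed
    then show ?thesis by (rule Lim_transform[rotated]) (intro tendsto_intros a)
  qed
  \<comment> \<open>For r = 0 the denominator itself tends to 1, so it is not rescaled by m.\<close>
  have deg0: "(\<lambda>n. L 0 n + U 0 n) \<longlonglongrightarrow> 1"
  proof -
    have "(\<lambda>n. q n * ((a n) ^ 3 + (a n)\<^sup>2 * c n) / m n) \<longlonglongrightarrow> 0"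
      unfolding power2_eq_square power3_eq_cube by (intro null bigO_intros)
    then have "(\<lambda>n. L 0 n + U 0 n - 1) \<longlonglongrightarrow> 0"
    proof (rule Lim_null_comparison[rotated])
      show "eventually (\<lambda>n. norm (L 0 n + U 0 n - 1) \<le> q n * ((a n) ^ 3 + (a n)\<^sup>2 * c n) / m n) sequentially"
        using ok
      proof eventually_elim
        case (elim n)
        then interpret active_graph n "m n" "P n" .
        have "L 0 n + U 0 n - 1 = - ?E n (\<lambda>D. of_bool (deg D \<noteq> 0))"
          unfolding L_def U_def deg_eq_0_prob by simp
        moreover have "?E n (\<lambda>D. of_bool (deg D \<noteq> 0)) \<ge> 0" by simp
        moreover have "?E n (\<lambda>D. of_bool (deg D \<noteq> 0)) \<le> q n * ((a n) ^ 3 + (a n)\<^sup>2 * c n) / m n"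
          unfolding a_def c_def q_def p_def by (rule scaled_bounds)
        ultimately show ?case by simp
      qed
    qed
    then show ?thesis by (simp add: LIM_zero_iff)
  qed
  have t: "(\<lambda>n. (m n)\<^sup>2 * t n) \<longlonglongrightarrow> \<mu> ^ 3"
  proof -
    have "(\<lambda>n. (c n) ^ 3 / m n) \<longlonglongrightarrow> 0"
      unfolding power3_eq_cube by (intro null bigO_intros)
    then have "(\<lambda>n. (m n)\<^sup>2 * t n - (a n) ^ 3) \<longlonglongrightarrow> 0"
    proof (rule Lim_null_comparison[rotated])
      show "eventually (\<lambda>n. norm ((m n)\<^sup>2 * t n - (a n) ^ 3) \<le> (c n) ^ 3 / m n) sequentially"
        using ok by eventually_elim
          (simp only: real_norm_def t_def a_def c_def p_def, rule active_graph.scaled_bounds)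
    qed
    then show ?thesis by (rule Lim_transform[rotated]) (intro tendsto_intros a)
  qed
  have u: "\<exists>C. eventually (\<lambda>n. 0 \<le> (m n)\<^sup>2 * u n \<and> (m n)\<^sup>2 * u n \<le> C) sequentially"
  proof -
    have "(\<lambda>n. (a n) ^ 3 + (a n)\<^sup>2 * c n) \<in> O(\<lambda>_. 1)"
      unfolding power2_eq_square power3_eq_cube by (intro bigO_intros)
    then obtain C where "eventually (\<lambda>n. norm ((a n) ^ 3 + (a n)\<^sup>2 * c n) \<le> C) sequentially"
      by (elim landau_o.bigE) auto
    with ok have "eventually (\<lambda>n. 0 \<le> (m n)\<^sup>2 * u n \<and> (m n)\<^sup>2 * u n \<le> C) sequentially"
    proof eventually_elim
      case (elim n)
      have "(m n)\<^sup>2 * u n \<le> (a n) ^ 3 + (a n)\<^sup>2 * c n"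
        unfolding u_def a_def c_def p_def by (rule active_graph.scaled_bounds[OF elim(1)])
      then show ?case using elim(2) nonneg by auto
    qed
    then show ?thesis ..
  qed
  then obtain C where C: "eventually (\<lambda>n. 0 \<le> (m n)\<^sup>2 * u n \<and> (m n)\<^sup>2 * u n \<le> C) sequentially" ..
  have err: "(\<lambda>n. (q n * (a n + c n) * c n)\<^sup>2 / m n) \<longlonglongrightarrow> 0"
    unfolding power2_eq_square by (intro null bigO_intros)
  have U1: "(\<lambda>n. m n * U 1 n - 1 / \<beta> * ((m n)\<^sup>2 * u n)) \<longlonglongrightarrow> 0"
  proof -
    have "(\<lambda>n. m n * U 1 n - (real n - 2) / m n * ((m n)\<^sup>2 * u n)) \<longlonglongrightarrow> 0"
      using err
    proof (rule Lim_null_comparison[rotated])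
      show "eventually (\<lambda>n. norm (m n * U 1 n - (real n - 2) / m n * ((m n)\<^sup>2 * u n)) \<le>
          (q n * (a n + c n) * c n)\<^sup>2 / m n) sequentially"
        using ok by eventually_elim
          (simp only: real_norm_def U_def u_def q_def a_def c_def p_def, rule active_graph.scaled_bounds)
    qed
    \<comment> \<open>Replacing (n - 2) / m by its limit is harmless because m^2 u is
      bounded.\<close>
    moreover have "(\<lambda>n. ((real n - 2) / m n - 1 / \<beta>) * ((m n)\<^sup>2 * u n)) \<longlonglongrightarrow> 0"
    proof (rule lim_null_mult_right_bounded)
      have "(\<lambda>n. q n - 2 / m n - 1 / \<beta>) \<longlonglongrightarrow> 1 / \<beta> - 0 - 1 / \<beta>"
        by (intro tendsto_intros q null) auto
      then show "(\<lambda>n. (real n - 2) / m n - 1 / \<beta>) \<longlonglongrightarrow> 0" by (simp add: q_def diff_divide_distrib)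
      show "eventually (\<lambda>n. norm ((m n)\<^sup>2 * u n) \<le> C) sequentially" using C by eventually_elim simp
    qed
    ultimately have "(\<lambda>n. m n * U 1 n - (real n - 2) / m n * ((m n)\<^sup>2 * u n) +
        ((real n - 2) / m n - 1 / \<beta>) * ((m n)\<^sup>2 * u n)) \<longlonglongrightarrow> 0 + 0"
      by (rule tendsto_add)
    then show ?thesis by (simp add: algebra_simps)
  qed

  have cl: "eventually (\<lambda>n. clustering_function n (m n) (P n) r = L r n / (L r n + U r n)) sequentially" for r
    using ok by eventually_elim (simp only: active_graph.clustering_function_eq L_def U_def)
  have cl': "eventually (\<lambda>n. clustering_function n (m n) (P n) r =
      (m n * L r n) / (m n * L r n + m n * U r n)) sequentially" for r
    using cl[of r] pos by eventually_elim (simp add: distrib_left[symmetric])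

  have "(\<lambda>n. clustering_function n (m n) (P n) 0) \<sim>[sequentially] (\<lambda>n. edge_probability n (m n) (P n) * exp (- \<Lambda>))"
  proof (rule asymp_equivI')
    \<comment> \<open>\<open>L 0\<close> and the edge probability are both of order 1/m; multiplying
      each by m gives finite positive limits.\<close>
    have "(\<lambda>n. (m n * L 0 n) / (L 0 n + U 0 n) / (m n * edge_probability n (m n) (P n) * exp (- \<Lambda>)))
        \<longlonglongrightarrow> (\<mu>\<^sup>2 * (\<Lambda> ^ 0 / fact 0 * exp (- \<Lambda>))) / 1 / (\<mu>\<^sup>2 * exp (- \<Lambda>))"
      using \<mu> by (intro tendsto_intros L deg0 edge) auto
    moreover have "eventually (\<lambda>n. (m n * L 0 n) / (L 0 n + U 0 n) / (m n * edge_probability n (m n) (P n) * exp (- \<Lambda>)) =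
        clustering_function n (m n) (P n) 0 / (edge_probability n (m n) (P n) * exp (- \<Lambda>))) sequentially"
      using cl[of 0] pos by eventually_elim simp
    ultimately show "(\<lambda>n. clustering_function n (m n) (P n) 0 / (edge_probability n (m n) (P n) * exp (- \<Lambda>))) \<longlonglongrightarrow> 1"
      using \<mu> by (simp add: tendsto_cong)
  qed
  moreover have "(\<lambda>n. clustering_function n (m n) (P n) 1) \<sim>[sequentially]
      (\<lambda>n. let \<alpha> = clustering_coefficient n (m n) (P n) in \<alpha> / (\<alpha> + (1 - \<alpha>) * exp \<Lambda>))"
  proof -
    have "(\<lambda>n. (m n * L 1 n) / (m n * L 1 n + m n * U 1 n)) \<sim>[sequentially]
        (\<lambda>n. ((m n)\<^sup>2 * t n) / ((m n)\<^sup>2 * t n + (m n)\<^sup>2 * u n * exp \<Lambda>))"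
    proof (rule ratio_asymp_equiv[OF _ t U1 C])
      \<comment> \<open>The limit \<mu>^2 \<Lambda> exp (- \<Lambda>) is A k exp (- \<Lambda>) with
        A = \<mu>^3, the limit of m^2 t, and k = 1 / \<beta>.\<close>
      show "(\<lambda>n. m n * L 1 n) \<longlonglongrightarrow> \<mu> ^ 3 * (1 / \<beta>) * exp (- \<Lambda>)"
        using L[of 1] by (simp add: \<Lambda> power2_eq_square power3_eq_cube mult.assoc)
    qed (use \<mu> \<beta> nonneg in auto)
    moreover have "eventually (\<lambda>n. ((m n)\<^sup>2 * t n) / ((m n)\<^sup>2 * t n + (m n)\<^sup>2 * u n * exp \<Lambda>) =
        (let \<alpha> = clustering_coefficient n (m n) (P n) in \<alpha> / (\<alpha> + (1 - \<alpha>) * exp \<Lambda>))) sequentially"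
      using ok pos order_tendstoD(1)[OF t \<mu>3]
    proof eventually_elim
      case (elim n)
      \<comment> \<open>Keeps the denominator t + u of \<alpha> nonzero; it then cancels from the
        formula.\<close>
      have "t n > 0" using elim \<mu> nonneg(3)[of n] by (simp add: zero_less_mult_iff)
      then have s: "t n + u n > 0" using nonneg(4)[of n] by simp
      have \<alpha>: "clustering_coefficient n (m n) (P n) = t n / (t n + u n)"
        using elim by (simp only: active_graph.clustering_coefficient_eq t_def u_def)
      have \<alpha>': "1 - t n / (t n + u n) = u n / (t n + u n)" using s by (simp add: field_simps)
      have "t n / (t n + u n) / (t n / (t n + u n) + u n / (t n + u n) * exp \<Lambda>) = t n / (t n + u n * exp \<Lambda>)"
        using s by (simp add: add_divide_distrib[symmetric])
      also have "\<dots> = ((m n)\<^sup>2 * t n) / ((m n)\<^sup>2 * t n + (m n)\<^sup>2 * u n * exp \<Lambda>)"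
        using elim by (simp add: distrib_left[symmetric] mult.assoc)
      finally show ?case by (simp add: Let_def \<alpha> \<alpha>')
    qed
    ultimately show ?thesis
      by (subst asymp_equiv_cong[OF cl'[of 1] eventually_mono[OF _ sym]])
  qed
  moreover have "(\<lambda>n. clustering_function n (m n) (P n) r) \<longlonglongrightarrow> 1" if r: "r \<ge> 2" for r
  proof -
    have U: "(\<lambda>n. m n * U r n) \<longlonglongrightarrow> 0"
      using err
    proof (rule Lim_null_comparison[rotated])
      show "eventually (\<lambda>n. norm (m n * U r n) \<le> (q n * (a n + c n) * c n)\<^sup>2 / m n) sequentially"
        using ok
      proof eventually_elim
        case (elim n)
        have "m n * U r n \<le> (q n * (a n + c n) * c n)\<^sup>2 / m n"
          unfolding U_def q_def a_def c_def p_def by (rule active_graph.scaled_bounds(7)[OF elim r])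
        then show ?case using nonneg(2)[of r n] by simp
      qed
    qed
    define l where "l = \<mu>\<^sup>2 * (\<Lambda> ^ r / fact r * exp (- \<Lambda>))"
    \<comment> \<open>Positivity of the Poisson weight at r makes the adjacent part dominate the
      vanishing m U r.\<close>
    have "l > 0" using \<mu> \<beta> by (simp add: l_def \<Lambda>)
    then have "(\<lambda>n. (m n * L r n) / (m n * L r n + m n * U r n)) \<longlonglongrightarrow> l / (l + 0)"
      using L[of r, folded l_def] U by (intro tendsto_intros) auto
    then show ?thesis using \<open>l > 0\<close> cl'[of r] by (simp add: tendsto_cong)
  qed
  ultimately show ?thesis by blast
qed

end
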